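(* Let $d\ge2$, $k>0$, and let $G_k$ be the Green function of the unit ball $\mathbb{B}$ for the rank one Dunkl Laplacian in $\mathbb{R}^d$. Put $\Phi(x,y):=|x-y|\vee|x-\sigma y|$ and $\delta(x):=1-|x|$. Then, for $x,y\in\mathbb{B}$, with constants in $\asymp$ depending only on $d$ and $k$: 1. If $d=2$, then $$G_k(x,y)\asymp\frac{1}{\Phi(x,y)^{2k}}\left(1\wedge\frac{\delta(x)\delta(y)}{|x-y|^2}\right)\left[1\vee\log\left(\frac{|x_1y_1|\wedge\delta(x)\delta(y)}{|x-y|^2}\right)\right]\left[1\vee\log\left(\frac{|x_1y_1|}{\delta(x)\delta(y)\vee|x-\sigma y|^2}\right)\right].$$ 2. If $d=3$, then $$G_k(x,y)\asymp\frac{1}{\Phi(x,y)^{2k}|x-y|}\left(1\wedge\frac{\sqrt{\delta(x)\delta(y)}}{|x-y|}\right)\left(1\wedge\frac{\sqrt{\delta(x)\delta(y)}}{|x-y|\wedge|x-\sigma y|}\right).$$ 3. If $d=4$, then $$G_k(x,y)\asymp\frac{1}{\Phi(x,y)^{2k}|x-y|^2}\left(1\wedge\frac{\delta(x)\delta(y)}{|x-y|^2\wedge|x-\sigma y|^2}\right)\left[1\vee\log\left(\frac{|x_1y_1|\wedge\delta(x)\delta(y)}{|x-\sigma y|^2}\right)\right].$$ 4. If $d\ge5$, then $$G_k(x,y)\asymp\frac{1}{\Phi(x,y)^{2k}(|x-y|\wedge|x-\sigma y|)^{d-4}|x-y|^2}\left(1\wedge\frac{\delta(x)\delta(y)}{|x-y|^2\wedge|x-\sigma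 y|^2}\right).$$
   Context: Rank one setting: $x=(x_1,\dots,x_d)$ are coordinates in an orthonormal basis of $\mathbb{R}^d$ such that the root system is $\{\pm\alpha\}$ with $\alpha=(\sqrt2,0,\dots,0)$, the reflection is $\sigma(x_1,x_2,\dots,x_d)=(-x_1,x_2,\dots,x_d)$, and the multiplicity is a number $k>0$ (so $\gamma=k$ and $d+2k>2$). $\mathbb{B}=\{|x|<1\}$. The Green function of $\mathbb{B}$ is $$G_k(x,y)=c_kC_k\int_{-1}^1\Bigl[\bigl(|x|^2+|y|^2-2s_t\bigr)^{1-k-d/2}-\bigl(1+|x|^2|y|^2-2s_t\bigr)^{1-k-d/2}\Bigr](1-t)^{k-1}(1+t)^k\,dt\in[0,\infty],$$ with $s_t=tx_1y_1+x_2y_2+\dots+x_dy_d$, where $c_k=\frac{\Gamma(k+1/2)}{\sqrt\pi\,\Gamma(k)}$, $C_k=\frac{1}{d_k(d+2k-2)}$, $d_k=\int_{\mathbb{S}}|\langle\alpha,x\rangle|^{2k}dS(x)$, $\mathbb{S}$ being the unit sphere with surface measure $dS$. $f\asymp g$ means $C^{-1}g\le f\le Cg$ for a constant $C>0$ depending on $d$ and $k$ only. $a\vee b=\max(a,b)$, $a\wedge b=\min(a,b)$. Conventions: $a/0=+\infty$ for $a>0$, $\log0=-\infty$, $\log(+\infty)=+\infty$; if the argument of a logarithm is $0/0$ the corresponding bracket is read as $1$ (the prefactor is then $+\infty$). *)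

theory Defs
  imports "HOL-Analysis.Analysis"
begin

(* The surface measure of the unit sphere via polar coordinates:
   the measure of A is d times the Lebesgue volume of the cone {r *R w | 0 < r < 1, w : A}.
   Recall that sgn x = x /R norm x. *)
definition sphere_measure :: "'a::euclidean_space measure" where
  "sphere_measure =
     scale_measure (of_nat DIM('a))
       (distr (restrict_space lborel (ball 0 1 - {0})) (restrict_space borel (sphere 0 1)) sgn)"

lemma measurable_sgn_sphere:
  "sgn \<in> restrict_space lborel (ball 0 1 - {0})
          \<rightarrow>\<^sub>M restrict_space borel (sphere 0 (1::real) :: 'a::euclidean_space set)"
proof (rule measurable_restrict_space2)
  show "sgn \<in> space (restrict_space lborel (ball 0 1 - {0 :: 'a})) \<rightarrow> sphere 0 1"
    by (auto simp: space_restrict_space norm_sgn)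
  have "continuous_on (ball 0 1 - {0 :: 'a}) sgn"
    by (auto intro!: continuous_intros simp: sgn_div_norm [abs_def])
  then have "sgn \<in> borel_measurable (restrict_space borel (ball 0 1 - {0 :: 'a}))"
    by (rule borel_measurable_continuous_on_restrict)
  then show "sgn \<in> borel_measurable (restrict_space lborel (ball 0 1 - {0 :: 'a}))"
    by (simp cong: measurable_cong_sets add: sets_restrict_space)
qed

lemma emeasure_sphere_measure:
  fixes A :: "'a::euclidean_space set"
  assumes "A \<in> sets borel" "A \<subseteq> sphere 0 1"
  shows "emeasure sphere_measure A =
           of_nat DIM('a) * emeasure lborel {x \<in> ball 0 1 - {0}. sgn x \<in> A}"
proof -
  have A: "A \<in> sets (restrict_space borel (sphere 0 1))"
    using assms by (subst sets_restrict_space_iff) auto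
  have "sgn -` A \<inter> (ball 0 1 - {0}) = {x \<in> ball 0 1 - {0}. sgn x \<in> A}"
    by auto
  moreover have "emeasure (restrict_space lborel (ball 0 1 - {0})) {x \<in> ball 0 1 - {0}. sgn x \<in> A} =
      emeasure lborel {x \<in> ball 0 1 - {0}. sgn x \<in> A}"
    by (rule emeasure_restrict_space) auto
  ultimately show ?thesis
    by (simp only: sphere_measure_def emeasure_scale_measure
        emeasure_distr [OF measurable_sgn_sphere A] space_restrict_space
        space_lborel space_borel Int_UNIV_right)
qed

(* The index i marks the coordinate called x_1: the root system is {\<alpha> i, - \<alpha> i}. *)

definition \<alpha> :: "'n::finite \<Rightarrow> real ^ 'n" where
  "\<alpha> i = axis i (sqrt 2)"

definition \<sigma> :: "'n::finite \<Rightarrow> real ^ 'n \<Rightarrow> real ^ 'n" where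
  "\<sigma> i x = (\<chi> j. if j = i then - x $ j else x $ j)"

definition \<Phi> :: "'n::finite \<Rightarrow> real ^ 'n \<Rightarrow> real ^ 'n \<Rightarrow> real" where
  "\<Phi> i x y = max (norm (x - y)) (norm (x - \<sigma> i y))"

definition \<delta> :: "real ^ 'n::finite \<Rightarrow> real" where
  "\<delta> x = 1 - norm x"

definition c_const :: "real \<Rightarrow> real" where
  "c_const k = Gamma (k + 1/2) / (sqrt pi * Gamma k)"

definition d_const :: "'n::finite \<Rightarrow> real \<Rightarrow> real" where
  "d_const i k = (LINT x|(sphere_measure :: (real ^ 'n) measure). \<bar>\<alpha> i \<bullet> x\<bar> powr (2 * k))"

definition C_const :: "'n::finite \<Rightarrow> real \<Rightarrow> real" where
  "C_const i k = 1 / (d_const i k * (real CARD('n) + 2 * k - 2))"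

definition s_form :: "'n::finite \<Rightarrow> real \<Rightarrow> real ^ 'n \<Rightarrow> real ^ 'n \<Rightarrow> real" where
  "s_form i t x y = t * x $ i * y $ i + (\<Sum>j\<in>UNIV - {i}. x $ j * y $ j)"

(* Powers of nonnegative reals with values in [0, \<infinity>]; in the library 0 powr p = 0 for all p. *)
definition epowr :: "real \<Rightarrow> real \<Rightarrow> ennreal" where
  "epowr r p = (if r = 0 \<and> p < 0 then \<infinity> else ennreal (r powr p))"

(* On the unit ball, 0 \<le> |x|^2 + |y|^2 - 2 s_t < 1 + |x|^2 |y|^2 - 2 s_t for -1 < t < 1,
   so the (truncated) ennreal difference is the true one. It is \<infinity> if the first base vanishes,
   which for -1 < t < 1 happens exactly if x = y and x $ i = 0. *)
definition green :: "real \<Rightarrow> 'n::finite \<Rightarrow> real ^ 'n \<Rightarrow> real ^ 'n \<Rightarrow> ennreal" where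
  "green k i x y =
     ennreal (c_const k * C_const i k) *
     (\<integral>\<^sup>+ t \<in> {-1<..<1}.
        (epowr ((norm x)\<^sup>2 + (norm y)\<^sup>2 - 2 * s_form i t x y) (1 - k - real CARD('n) / 2)
         - epowr (1 + (norm x)\<^sup>2 * (norm y)\<^sup>2 - 2 * s_form i t x y) (1 - k - real CARD('n) / 2))
        * ennreal ((1 - t) powr (k - 1) * (1 + t) powr k) \<partial>lborel)"

definition elog :: "ereal \<Rightarrow> ereal" where
  "elog a = (if a \<le> 0 then - \<infinity> else if a = \<infinity> then \<infinity> else ereal (ln (real_of_ereal a)))"

(* Division in ereal satisfies a / 0 = \<infinity> for a > 0 and 0 / 0 = 0. The following thus says that
   a bracket whose logarithm has the argument 0 / 0 is read as 1. *)
lemma elog_bracket_zero_over_zero: "max 1 (elog (0 / 0)) = 1"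
  by (simp add: elog_def)

(* Two-sided comparability on the ball, with one constant for all choices of the marked
   coordinate i: it depends only on the dimension and on the parameters of f and g. *)
definition comparable ::
    "('n::finite \<Rightarrow> real ^ 'n \<Rightarrow> real ^ 'n \<Rightarrow> ereal) \<Rightarrow>
     ('n \<Rightarrow> real ^ 'n \<Rightarrow> real ^ 'n \<Rightarrow> ereal) \<Rightarrow> bool" where
  "comparable f g \<longleftrightarrow>
     (\<exists>C::real. C > 0 \<and> (\<forall>i. \<forall>x\<in>ball 0 1. \<forall>y\<in>ball 0 1.
        ereal (1 / C) * g i x y \<le> f i x y \<and> f i x y \<le> ereal C * g i x y))"

end

theory Submission
  imports Defs
begin

text \<open>
  Put \<open>A = |x - y|^2\<close>, \<open>B = |x - \<sigma> y|^2\<close>, \<open>p = x_1 y_1\<close> and \<open>\<Delta> = \<delta>(x) \<delta>(y)\<close>. Then \<open>B = A + 4 p\<close>. In the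
  integral that defines the Green function the first base moves linearly in \<open>t\<close>, from \<open>B\<close> at
  \<open>t = -1\<close> to \<open>A\<close> at \<open>t = 1\<close>, and the second base exceeds it by the constant
  \<open>D = (1 - |x|^2) (1 - |y|^2)\<close>, which lies between \<open>\<Delta>\<close> and \<open>4 \<Delta>\<close>. Let \<open>a \<le> b\<close> be \<open>A\<close> and \<open>B\<close> in
  increasing order. Up to a constant factor the Green function is therefore the segment integral
  \<open>\<integral>\<^sub>0\<^sup>1 (m^(-N) - (m + D)^(-N)) u^(q-1) (1-u)^(r-1) du\<close> with \<open>m = (1-u) a + u b\<close> and
  \<open>N = k + d/2 - 1\<close>. Since \<open>u = 0\<close> marks the end where the base is small, \<open>(q, r)\<close> is \<open>(k, k+1)\<close>
  if \<open>p \<ge> 0\<close> and \<open>(k+1, k)\<close> if \<open>p < 0\<close>. This asymmetry of the weight is the reason why \<open>|x - y|\<close> and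
  \<open>|x - \<sigma> y|\<close> enter the estimates differently.

  The difference of powers is comparable to \<open>m^(-N) min(1, \<Delta>/m)\<close>, which is decreasing and changes
  at most by a constant factor when \<open>m\<close> is doubled. So \<open>m\<close> can be replaced by \<open>b\<close> for \<open>u \<ge> 1/2\<close>, by
  \<open>a\<close> for \<open>u < a/b\<close>, and by \<open>v = b u\<close> in between. This gives the upper bound
  \<open>b^(-q) [b^(q-N) min(1, \<Delta>/b) + a^(q-N) min(1, \<Delta>/a) + \<integral> v^(q-N-1) min(1, \<Delta>/v) dv]\<close> with the
  integral over \<open>a \<le> v \<le> b\<close> (\<open>segment_integral_upper\<close>). Conversely, every
  \<open>b^(-q) m^(q-N) min(1, \<Delta>/m)\<close> with \<open>a \<le> m \<le> b\<close>, and every part of the \<open>v\<close>-integral that stays below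
  \<open>b/2\<close>, is a lower bound up to a constant (\<open>segment_integral_lower_point\<close>,
  \<open>segment_integral_lower_range\<close>).

  What remains is one-variable calculus, and only \<open>q - N\<close> matters; it is \<open>1 - d/2\<close> for \<open>p \<ge> 0\<close> and
  \<open>2 - d/2\<close> for \<open>p < 0\<close>. If it is negative, the \<open>v\<close>-integral is concentrated at its lower end and there
  is no logarithm (\<open>segment_estimate_power\<close>); this covers \<open>p \<ge> 0\<close> for \<open>d \<ge> 3\<close> and \<open>p < 0\<close> for \<open>d \<ge> 5\<close>.
  If it is \<open>0\<close>, the stretch \<open>a \<le> v \<le> min(b, \<Delta>)\<close> produces a logarithm (\<open>segment_estimate_log\<close>);
  these are the cases \<open>d = 2\<close>, \<open>p \<ge> 0\<close> and \<open>d = 4\<close>, \<open>p < 0\<close>. For \<open>d = 3\<close>, \<open>p < 0\<close> it is \<open>1/2\<close> and the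
  integral is concentrated near the point of \<open>[a, b]\<close> closest to \<open>\<Delta>\<close> (\<open>segment_estimate_sqrt\<close>). For
  \<open>d = 2\<close>, \<open>p < 0\<close> it is \<open>1\<close> and the stretch \<open>max(a, \<Delta>) \<le> v \<le> b\<close> produces the logarithm
  (\<open>segment_estimate_linear\<close>).
\<close>

section \<open>The difference of two powers\<close>

text \<open>Both bounds rest on \<open>exp s \<ge> 1 + s\<close>. It gives \<open>(1 + z)^(-N) \<ge> 1 - N ln (1 + z) \<ge> 1 - N z\<close> for the upper
bound, and \<open>(1 + w)^N \<ge> 1 + N ln (1 + w) \<ge> 1 + N w / 2\<close> with \<open>w = min 1 z\<close> for the lower one.\<close>
lemma one_minus_powr_bounds:
  fixes N z :: real
  assumes N: "N > 0" and z: "z > 0"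
  shows "N / (N + 2) * min 1 z \<le> 1 - (1 + z) powr (- N)"
    and "1 - (1 + z) powr (- N) \<le> max 1 N * min 1 z"
proof -
  define w where "w = min 1 z"
  have w: "0 < w" "w \<le> 1" "w \<le> z" using z by (auto simp: w_def)
  have "w / 2 \<le> ln (1 + w)"
  proof -
    have "- ln (1 + w) \<le> 1 / (1 + w) - 1"
      using ln_le_minus_one[of "1 / (1 + w)"] w by (simp add: ln_div)
    moreover have "1 / (1 + w) - 1 \<le> - (w / 2)"
      using w by (simp add: field_simps power2_eq_square mult_left_le)
    ultimately show ?thesis by linarith
  qed
  then have "1 + N * w / 2 \<le> 1 + N * ln (1 + w)" using N by (simp add: field_simps)
  also have "\<dots> \<le> exp (N * ln (1 + w))" by (rule exp_ge_add_one_self)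
  also have "\<dots> = (1 + w) powr N" using w by (simp add: powr_def mult.commute)
  also have "\<dots> \<le> (1 + z) powr N" using w N by (intro powr_mono2) auto
  finally have "1 + N * w / 2 \<le> (1 + z) powr N" .
  moreover have "0 < 1 + N * w / 2" using N w by (simp add: add_pos_pos)
  ultimately have "(1 + z) powr (- N) \<le> 1 / (1 + N * w / 2)"
    by (simp add: powr_minus_divide frac_le)
  moreover have "N / (N + 2) * w \<le> 1 - 1 / (1 + N * w / 2)"
  proof -
    have "1 - 1 / (1 + N * w / 2) = N * w / (2 + N * w)"
      using N w \<open>0 < 1 + N * w / 2\<close> by (simp add: field_simps)
    moreover have "N * w / (N + 2) \<le> N * w / (2 + N * w)"
      using N w by (intro divide_left_mono) (auto simp: add_pos_pos)
    ultimately show ?thesis by simp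
  qed
  ultimately show "N / (N + 2) * min 1 z \<le> 1 - (1 + z) powr (- N)"
    by (simp add: w_def)
next
  have "1 - N * z \<le> 1 + - N * ln (1 + z)"
    using N z ln_add_one_self_le_self[of z] by simp
  also have "\<dots> \<le> exp (- N * ln (1 + z))" by (rule exp_ge_add_one_self)
  also have "\<dots> = (1 + z) powr (- N)" using z by (simp add: powr_def mult.commute)
  finally have *: "1 - (1 + z) powr (- N) \<le> N * z" by simp
  show "1 - (1 + z) powr (- N) \<le> max 1 N * min 1 z"
  proof (cases "z \<le> 1")
    case True
    have "N * z \<le> max 1 N * z" using z by (intro mult_right_mono) auto
    then show ?thesis using * True by (simp add: min_def)
  next
    case False
    have "1 - (1 + z) powr (- N) \<le> 1" by simp
    also have "1 \<le> max 1 N * min 1 z" using False by (simp add: min_def)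
    finally show ?thesis .
  qed
qed

text \<open>The size of \<open>m^(-N) - (m + D)^(-N)\<close> for \<open>D\<close> comparable to \<open>\<Delta>\<close>. At \<open>m = 0\<close> the conventions for division
and powers give the value \<open>0\<close>, so that terms with \<open>a = 0\<close> simply drop out of upper bounds.\<close>
definition profile :: "real \<Rightarrow> real \<Rightarrow> real \<Rightarrow> real" where
  "profile N \<Delta> m = m powr (- N) * min 1 (\<Delta> / m)"

lemma profile_nonneg: "m > 0 \<Longrightarrow> \<Delta> > 0 \<Longrightarrow> profile N \<Delta> m \<ge> 0"
  by (simp add: profile_def)

text \<open>Monotonicity (\<open>L = 1\<close>) and doubling (\<open>L = 2\<close>) in one inequality; every replacement of a point of the
segment by a comparable one goes through it.\<close>
lemma profile_scale:
  assumes "0 < m" "0 < m'" "m' \<le> L * m" "L \<ge> 1" "N \<ge> 0" "\<Delta> > 0"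
  shows "profile N \<Delta> m \<le> L powr (N + 1) * profile N \<Delta> m'"
proof -
  have "m' / L \<le> m" using assms by (simp add: field_simps)
  then have "m powr (- N) \<le> (m' / L) powr (- N)"
    using assms by (intro powr_mono2') auto
  also have "\<dots> = L powr N * m' powr (- N)"
    using assms by (simp add: powr_divide powr_minus field_simps)
  finally have 1: "m powr (- N) \<le> L powr N * m' powr (- N)" .
  have "\<Delta> / m \<le> L * (\<Delta> / m')"
    using assms mult_left_mono[of "m'" "L * m" \<Delta>] by (simp add: field_simps)
  moreover have "1 \<le> L * 1" using assms by simp
  ultimately have "min 1 (\<Delta> / m) \<le> L * min 1 (\<Delta> / m')"
    by (auto simp: min_def)
  with 1 have "profile N \<Delta> m \<le> (L powr N * m' powr (- N)) * (L * min 1 (\<Delta> / m'))"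
    unfolding profile_def using assms by (intro mult_mono) auto
  also have "\<dots> = L powr (N + 1) * profile N \<Delta> m'"
    using assms by (simp add: profile_def powr_add)
  finally show ?thesis .
qed

text \<open>With \<open>z = D / m\<close> the difference is \<open>m^(-N) (1 - (1 + z)^(-N))\<close>, so that \<open>one_minus_powr_bounds\<close> applies.\<close>
lemma epowr_diff_bounds:
  assumes "N > 0" "m > 0" "\<Delta> > 0" "\<Delta> \<le> D" "D \<le> 4 * \<Delta>"
  shows "ennreal (N / (N + 2) * profile N \<Delta> m) \<le> epowr m (- N) - epowr (m + D) (- N)"
    and "epowr m (- N) - epowr (m + D) (- N) \<le> ennreal (4 * max 1 N * profile N \<Delta> m)"
proof -
  define z where "z = D / m"
  have z: "z > 0" using assms by (simp add: z_def)
  have "m + D = m * (1 + z)"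
    using assms by (simp add: z_def distrib_left)
  then have "(m + D) powr (- N) = (m * (1 + z)) powr (- N)" by simp
  also have "\<dots> = m powr (- N) * (1 + z) powr (- N)"
    using assms z by (simp add: powr_mult)
  finally have e: "epowr m (- N) - epowr (m + D) (- N) = ennreal (m powr (- N) * (1 - (1 + z) powr (- N)))"
    using assms by (simp add: epowr_def ennreal_minus algebra_simps)
  have "\<Delta> / m \<le> z" "z \<le> 4 * (\<Delta> / m)"
    using assms by (auto simp: z_def field_simps)
  then have min: "min 1 (\<Delta> / m) \<le> min 1 z" "min 1 z \<le> 4 * min 1 (\<Delta> / m)"
    by auto
  have "N / (N + 2) * min 1 (\<Delta> / m) \<le> N / (N + 2) * min 1 z"
    using assms min by (intro mult_left_mono) auto
  also have "\<dots> \<le> 1 - (1 + z) powr (- N)"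
    using one_minus_powr_bounds(1) assms z by auto
  finally have "m powr (- N) * (N / (N + 2) * min 1 (\<Delta> / m)) \<le> m powr (- N) * (1 - (1 + z) powr (- N))"
    by (intro mult_left_mono) auto
  then show "ennreal (N / (N + 2) * profile N \<Delta> m) \<le> epowr m (- N) - epowr (m + D) (- N)"
    unfolding e profile_def by (intro ennreal_leI) (simp add: mult_ac)
  have "1 - (1 + z) powr (- N) \<le> max 1 N * min 1 z"
    using one_minus_powr_bounds(2) assms z by auto
  also have "\<dots> \<le> max 1 N * (4 * min 1 (\<Delta> / m))"
    using min by (intro mult_left_mono) auto
  finally have "m powr (- N) * (1 - (1 + z) powr (- N)) \<le> m powr (- N) * (max 1 N * (4 * min 1 (\<Delta> / m)))"
    by (intro mult_left_mono) auto
  then show "epowr m (- N) - epowr (m + D) (- N) \<le> ennreal (4 * max 1 N * profile N \<Delta> m)"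
    unfolding e profile_def by (intro ennreal_leI) (simp add: mult_ac)
qed

section \<open>Weighted integrals over a segment\<close>

lemma nn_integral_powr_from_0:
  fixes c s :: real
  assumes "0 < s" "0 \<le> c"
  shows "(\<integral>\<^sup>+u\<in>{0..c}. ennreal (u powr (s - 1)) \<partial>lborel) = ennreal (c powr s / s)"
proof -
  have "((\<lambda>u. u powr (s - 1)) has_integral (c powr s / s)) {0..c}"
    using has_integral_powr_from_0[of "s - 1" c] assms by simp
  then have "(\<integral>\<^sup>+u. ennreal (indicator {0..c} u * u powr (s - 1)) \<partial>lborel) = ennreal (c powr s / s)"
    by (intro nn_integral_has_integral_lebesgue) auto
  moreover have "ennreal (indicator {0..c} u * u powr (s - 1)) = ennreal (u powr (s - 1)) * indicator {0..c} u" for u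
    by (auto simp: indicator_def)
  ultimately show ?thesis by simp
qed

text \<open>Away from the end where it degenerates, a power weight is comparable to \<open>1\<close>, whatever the sign of the
exponent.\<close>
lemma powr_le_on_half:
  fixes v s :: real
  assumes "1/2 \<le> v" "v \<le> 1"
  shows "v powr s \<le> 1 + 2 powr (- s)" "min 1 (2 powr (- s)) \<le> v powr s"
proof -
  have e: "(1/2::real) powr s = 2 powr (- s)" by (simp add: powr_divide powr_minus field_simps)
  have "s \<ge> 0 \<Longrightarrow> v powr s \<le> 1 \<and> 2 powr (- s) \<le> v powr s"
    using powr_mono2[of s v 1] powr_mono2[of s "1/2" v] assms e by simp
  moreover have "s \<le> 0 \<Longrightarrow> v powr s \<le> 2 powr (- s) \<and> 1 \<le> v powr s"
    using powr_mono2'[of s v 1] powr_mono2'[of s "1/2" v] assms e by simp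
  moreover have "0 < 2 powr (- s)" by simp
  ultimately show "v powr s \<le> 1 + 2 powr (- s)" "min 1 (2 powr (- s)) \<le> v powr s"
    by (smt (verit))+
qed

text \<open>The parameter \<open>u\<close> runs from the end \<open>a\<close> to the end \<open>b\<close>, and \<open>q\<close> is the exponent of the weight at \<open>a\<close>.\<close>
definition segment_integral :: "real \<Rightarrow> real \<Rightarrow> real \<Rightarrow> real \<Rightarrow> real \<Rightarrow> real \<Rightarrow> ennreal" where
  "segment_integral q r N D a b =
     (\<integral>\<^sup>+u\<in>{0<..<1}. (epowr ((1 - u) * a + u * b) (- N) - epowr ((1 - u) * a + u * b + D) (- N))
        * ennreal (u powr (q - 1) * (1 - u) powr (r - 1)) \<partial>lborel)"

text \<open>The bounds on \<open>D\<close> are those of \<open>(1 - |x|^2) (1 - |y|^2)\<close> in terms of \<open>\<Delta> = \<delta>(x) \<delta>(y)\<close> on the ball. The degenerate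
segment \<open>a = b = 0\<close> is excluded, since there the integrand is infinite throughout.\<close>
definition admissible :: "real \<Rightarrow> real \<Rightarrow> real \<Rightarrow> real \<Rightarrow> bool" where
  "admissible \<Delta> D a b \<longleftrightarrow> 0 < \<Delta> \<and> \<Delta> \<le> D \<and> D \<le> 4 * \<Delta> \<and> 0 \<le> a \<and> a \<le> b \<and> 0 < b"

lemma profile_measurable [measurable]: "profile N \<Delta> \<in> borel_measurable borel"
  unfolding profile_def[abs_def] by measurable

lemma epowr_measurable [measurable]: "(\<lambda>m. epowr m p) \<in> borel_measurable borel"
  unfolding epowr_def[abs_def] by measurable

locale weights =
  fixes q r N :: real
  assumes q: "q > 0" and r: "r > 0" and N: "N > 0"
begin

text \<open>The three summands are the contributions of \<open>u \<ge> 1/2\<close>, of \<open>u < a/b\<close> and of the rest. There the point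
of the segment is bounded below by half of \<open>b\<close>, of \<open>a\<close> and of \<open>b u\<close>, respectively, and one of the two weights is
bounded. The last contribution becomes an integral over \<open>v\<close> by the substitution \<open>v = b u\<close>.\<close>
lemma segment_integral_upper:
  "\<exists>C>0. \<forall>\<Delta> D a b. admissible \<Delta> D a b \<longrightarrow>
     segment_integral q r N D a b \<le> ennreal (C * b powr (- q)) *
       (ennreal (b powr q * profile N \<Delta> b) + ennreal (a powr q * profile N \<Delta> a)
        + (\<integral>\<^sup>+v\<in>{a..b}. ennreal (v powr (q - 1) * profile N \<Delta> v) \<partial>lborel))"
proof -
  define c where "c = 4 * max 1 N * 2 powr (N + 1)"
  define Kq where "Kq = 1 + (2::real) powr (- (q - 1))"
  define Kr where "Kr = 1 + (2::real) powr (- (r - 1))"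
  have pos: "c > 0" "Kq > 0" "Kr > 0" by (auto simp: c_def Kq_def Kr_def add_pos_pos)
  define C where "C = c * (Kq / r + Kr / q + Kr)"
  have C: "C > 0" "c * Kq / r \<le> C" "c * Kr / q \<le> C" "c * Kr \<le> C"
    using pos q r by (auto simp: C_def distrib_left add_pos_pos)
  show ?thesis
  proof (intro exI[of _ C] conjI allI impI)
    fix \<Delta> D a b assume "admissible \<Delta> D a b"
    then have \<Delta>: "\<Delta> > 0" "\<Delta> \<le> D" "D \<le> 4 * \<Delta>" and ab: "0 \<le> a" "a \<le> b" "0 < b"
      by (auto simp: admissible_def)
    define P where "P = profile N \<Delta>"
    have P0: "P v \<ge> 0" if "v \<ge> 0" for v
      using that \<Delta> by (cases "v = 0") (auto simp: P_def profile_def)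
    define E where "E = (\<integral>\<^sup>+v\<in>{a..b}. ennreal (v powr (q - 1) * P v) \<partial>lborel)"
    let ?f = "\<lambda>u. (epowr ((1 - u) * a + u * b) (- N) - epowr ((1 - u) * a + u * b + D) (- N))
        * ennreal (u powr (q - 1) * (1 - u) powr (r - 1))"
    \<comment> \<open>The majorants of the integrand for the three ranges of \<open>u\<close>.\<close>
    let ?g1 = "\<lambda>u. ennreal (c * Kq * P b) * (ennreal ((1 - u) powr (r - 1)) * indicator {0..1} (1 - u))"
    let ?g2 = "\<lambda>u. ennreal (c * Kr * P a) * (ennreal (u powr (q - 1)) * indicator {0..a/b} u)"
    let ?h = "\<lambda>v. ennreal (v powr (q - 1) * P v) * indicator {a..b} v"
    let ?g3 = "\<lambda>u. ennreal (c * Kr * b powr (1 - q)) * ?h (b * u)"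
    have bound: "?f u * indicator {0<..<1} u \<le> ?g1 u + ?g2 u + ?g3 u" for u
    proof (cases "u \<in> {0<..<1}")
      case True
      define m where "m = (1 - u) * a + u * b"
      have u: "0 < u" "u < 1" using True by auto
      have ub: "u * b > 0" using u ab by simp
      have m1: "u * b \<le> m" using u ab by (simp add: m_def)
      have m2: "(1 - u) * a \<le> m" using u ab by (simp add: m_def)
      have m: "m > 0" using m1 ub by linarith
      have P_le: "4 * max 1 N * P m \<le> c * P m'" if "0 < m'" "m' \<le> 2 * m" for m'
        using mult_left_mono[OF profile_scale[of m m' 2 N \<Delta>], of "4 * max 1 N"] that m N \<Delta>
        by (simp add: c_def P_def mult_ac)
      have "?f u \<le> ennreal (4 * max 1 N * P m) * ennreal (u powr (q - 1) * (1 - u) powr (r - 1))"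
        using epowr_diff_bounds(2)[OF N m \<Delta>] unfolding m_def[symmetric] P_def
        by (intro mult_right_mono) auto
      also have "\<dots> = ennreal (4 * max 1 N * P m * (u powr (q - 1) * (1 - u) powr (r - 1)))"
        using m P0[of m] by (simp add: ennreal_mult')
      also have "\<dots> \<le> ?g1 u + ?g2 u + ?g3 u"
      proof (cases "u \<ge> 1/2")
        case True
        have "b \<le> 2 * u * b" using True ab by simp
        then have "b \<le> 2 * m" using m1 by linarith
        then have h1: "4 * max 1 N * P m \<le> c * P b" using P_le ab by blast
        have h2: "u powr (q - 1) * (1 - u) powr (r - 1) \<le> Kq * (1 - u) powr (r - 1)"
          unfolding Kq_def using True u by (intro mult_right_mono powr_le_on_half) auto
        have "4 * max 1 N * P m * (u powr (q - 1) * (1 - u) powr (r - 1))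
            \<le> c * P b * (Kq * (1 - u) powr (r - 1))"
          using pos ab P0[of b] by (intro mult_mono[OF h1 h2]) simp_all
        then have le: "4 * max 1 N * P m * (u powr (q - 1) * (1 - u) powr (r - 1)) \<le> c * Kq * P b * (1 - u) powr (r - 1)"
          by (simp only: mult_ac)
        have "1 - u \<in> {0..1}" using ab u  by (auto simp: field_simps)
        then have "?g1 u = ennreal (c * Kq * P b * (1 - u) powr (r - 1))"
          using pos ab u P0[of b] by (simp add: ennreal_mult')
        with le have "ennreal (4 * max 1 N * P m * (u powr (q - 1) * (1 - u) powr (r - 1))) \<le> ?g1 u"
          by (simp only: ennreal_leI)
        then show ?thesis by (simp add: add_increasing2 add.assoc)
      next
        case False
        have w: "u powr (q - 1) * (1 - u) powr (r - 1) \<le> u powr (q - 1) * Kr"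
          unfolding Kr_def using False u by (intro mult_left_mono powr_le_on_half) auto
        show ?thesis
        proof (cases "b * u < a")
          case True
          then have "a > 0" using ub by (simp add: mult.commute)
          have "a \<le> 2 * ((1 - u) * a)"
            using False \<open>a > 0\<close> by simp
          then have "a \<le> 2 * m" using m2 by linarith
          then have h1: "4 * max 1 N * P m \<le> c * P a" using P_le \<open>a > 0\<close> by blast
          have "4 * max 1 N * P m * (u powr (q - 1) * (1 - u) powr (r - 1))
              \<le> c * P a * (u powr (q - 1) * Kr)"
            using pos ab P0[of a] by (intro mult_mono[OF h1 w]) simp_all
          then have le: "4 * max 1 N * P m * (u powr (q - 1) * (1 - u) powr (r - 1)) \<le> c * Kr * P a * u powr (q - 1)"
          by (simp only: mult_ac)
        have "u \<in> {0..a / b}" using ab u True by (auto simp: field_simps)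
        then have "?g2 u = ennreal (c * Kr * P a * u powr (q - 1))"
          using pos ab u P0[of a] by (simp add: ennreal_mult')
        with le have "ennreal (4 * max 1 N * P m * (u powr (q - 1) * (1 - u) powr (r - 1))) \<le> ?g2 u"
          by (simp only: ennreal_leI)
          then show ?thesis by (simp add: add_increasing add_increasing2)
        next
          case b: False
          have h1: "4 * max 1 N * P m \<le> c * P (b * u)"
          proof (rule P_le)
            show "0 < b * u" using ub by (simp add: mult.commute)
            show "b * u \<le> 2 * m" using m1 m by (simp add: mult.commute)
          qed
          have "4 * max 1 N * P m * (u powr (q - 1) * (1 - u) powr (r - 1))
              \<le> c * P (b * u) * (u powr (q - 1) * Kr)"
            using pos ab u P0[of "b * u"] by (intro mult_mono[OF h1 w]) simp_all
          also have "\<dots> = c * Kr * b powr (1 - q) * ((b * u) powr (q - 1) * P (b * u))"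
            using ab u by (simp add: powr_mult mult_ac powr_diff)
          finally have le: "4 * max 1 N * P m * (u powr (q - 1) * (1 - u) powr (r - 1)) \<le> \<dots>" .
        have "b * u \<in> {a..b}" using ab u b by (auto simp: field_simps)
        then have "?g3 u = ennreal (c * Kr * b powr (1 - q) * ((b * u) powr (q - 1) * P (b * u)))"
          using pos ab u P0[of "b * u"] by (simp add: ennreal_mult')
        with le have "ennreal (4 * max 1 N * P m * (u powr (q - 1) * (1 - u) powr (r - 1))) \<le> ?g3 u"
          by (simp only: ennreal_leI)
          then show ?thesis by (simp add: add_increasing)
        qed
      qed
      finally show ?thesis using True by simp
    qed simp
    have [measurable]: "P \<in> borel_measurable borel" by (simp add: P_def)
    have "segment_integral q r N D a b \<le> (\<integral>\<^sup>+u. ?g1 u + ?g2 u + ?g3 u \<partial>lborel)"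
      unfolding segment_integral_def by (intro nn_integral_mono bound)
    also have "\<dots> = (\<integral>\<^sup>+u. ?g1 u \<partial>lborel) + (\<integral>\<^sup>+u. ?g2 u \<partial>lborel) + (\<integral>\<^sup>+u. ?g3 u \<partial>lborel)"
      by (subst nn_integral_add, measurable)+
    also have "(\<integral>\<^sup>+u. ?g1 u \<partial>lborel) = ennreal (c * Kq * P b) * ennreal (1 / r)"
    proof -
      have "(\<integral>\<^sup>+u. ennreal (u powr (r - 1)) * indicator {0..1} u \<partial>lborel)
          = (\<integral>\<^sup>+u. ennreal ((1 - u) powr (r - 1)) * indicator {0..1} (1 - u) \<partial>lborel)"
        using nn_integral_real_affine[of "\<lambda>u. ennreal (u powr (r - 1)) * indicator {0..1} u" "-1" 1] by simp
      then show ?thesis using nn_integral_powr_from_0[OF r, of 1]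
        by (subst nn_integral_cmult) auto
    qed
    also have "(\<integral>\<^sup>+u. ?g2 u \<partial>lborel) = ennreal (c * Kr * P a) * ennreal ((a / b) powr q / q)"
      using nn_integral_powr_from_0[OF q, of "a / b"] ab by (subst nn_integral_cmult) auto
    also have "(\<integral>\<^sup>+u. ?g3 u \<partial>lborel) = ennreal (c * Kr * b powr (- q)) * E"
    proof -
      have "E = ennreal b * (\<integral>\<^sup>+u. ?h (b * u) \<partial>lborel)"
        using nn_integral_real_affine[of ?h b 0] ab by (simp add: E_def)
      then have "ennreal (c * Kr * b powr (- q)) * E
          = ennreal (c * Kr * b powr (- q) * b) * (\<integral>\<^sup>+u. ?h (b * u) \<partial>lborel)"
        using ab pos by (simp add: ennreal_mult' mult.assoc)
      also have "c * Kr * b powr (- q) * b = c * Kr * b powr (1 - q)"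
        using ab by (simp add: powr_diff powr_minus field_simps)
      finally show ?thesis by (subst nn_integral_cmult) auto
    qed
    also have "ennreal (c * Kq * P b) * ennreal (1 / r) \<le> ennreal (C * b powr (- q)) * ennreal (b powr q * P b)"
    proof -
      have "c * Kq / r * P b \<le> C * P b" using C P0[of b] ab by (intro mult_right_mono) auto
      then have "ennreal (c * Kq * P b * (1 / r)) \<le> ennreal (C * b powr (- q) * (b powr q * P b))"
        using ab by (intro ennreal_leI) (simp add: powr_minus field_simps)
      then show ?thesis using r C pos ab P0[of b] by (simp only: ennreal_mult''[symmetric] ennreal_mult'[symmetric] mult_nonneg_nonneg less_imp_le powr_ge_zero zero_le_divide_1_iff)
    qed
    also have "ennreal (c * Kr * P a) * ennreal ((a / b) powr q / q)
        \<le> ennreal (C * b powr (- q)) * ennreal (a powr q * P a)"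
    proof -
      have "c * Kr / q * (b powr (-q) * (a powr q * P a)) \<le> C * (b powr (-q) * (a powr q * P a))"
        using C P0[of a] ab by (intro mult_right_mono) auto
      then have "ennreal (c * Kr * P a * ((a / b) powr q / q)) \<le> ennreal (C * b powr (- q) * (a powr q * P a))"
        using ab by (intro ennreal_leI) (simp add: powr_minus powr_divide field_simps)
      moreover have "0 \<le> (a / b) powr q / q" "0 \<le> a powr q * P a" using q ab P0[of a] by auto
      ultimately show ?thesis by (simp only: ennreal_mult''[symmetric])
    qed
    also have "ennreal (c * Kr * b powr (- q)) * E \<le> ennreal (C * b powr (- q)) * E"
      using C by (intro mult_right_mono ennreal_leI) auto
    finally show "segment_integral q r N D a b \<le> ennreal (C * b powr (- q)) *
       (ennreal (b powr q * profile N \<Delta> b) + ennreal (a powr q * profile N \<Delta> a)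
        + (\<integral>\<^sup>+v\<in>{a..b}. ennreal (v powr (q - 1) * profile N \<Delta> v) \<partial>lborel))"
      by (simp add: distrib_left P_def E_def add_mono)
  qed (use C in simp)
qed

text \<open>For \<open>u \<le> 1/2\<close> the point of the segment is at most \<open>a + u b\<close> and the weight at the far end is bounded below.\<close>
lemma segment_integrand_lower:
  "\<exists>c>0. \<forall>\<Delta> D a b m u. admissible \<Delta> D a b \<longrightarrow> 0 < u \<longrightarrow> u \<le> 1/2 \<longrightarrow> 0 < m \<longrightarrow> a + u * b \<le> 2 * m \<longrightarrow>
     ennreal (c * profile N \<Delta> m * u powr (q - 1))
     \<le> (epowr ((1 - u) * a + u * b) (- N) - epowr ((1 - u) * a + u * b + D) (- N))
        * ennreal (u powr (q - 1) * (1 - u) powr (r - 1))"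
proof -
  define K where "K = min 1 ((2::real) powr (- (r - 1)))"
  define L where "L = (2::real) powr (N + 1)"
  define c where "c = N / (N + 2) / L * K"
  have pos: "K > 0" "L > 0" "N / (N + 2) > 0" using N by (auto simp: K_def L_def)
  show ?thesis
  proof (intro exI[of _ c] conjI allI impI)
    fix \<Delta> D a b m u :: real
    assume "admissible \<Delta> D a b" and u: "0 < u" "u \<le> 1/2" and m: "0 < m" "a + u * b \<le> 2 * m"
    then have \<Delta>: "\<Delta> > 0" "\<Delta> \<le> D" "D \<le> 4 * \<Delta>" and ab: "0 \<le> a" "a \<le> b" "0 < b"
      by (auto simp: admissible_def)
    define m' where "m' = (1 - u) * a + u * b"
    have "0 \<le> (1 - u) * a" "0 < u * b" "(1 - u) * a \<le> a" using ab u by (auto simp: mult_left_le_one_le)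
    then have m': "0 < m'" "m' \<le> 2 * m" using m unfolding m'_def by linarith+
    have "profile N \<Delta> m \<le> L * profile N \<Delta> m'"
      unfolding L_def using m m' N \<Delta> by (intro profile_scale) auto
    then have "profile N \<Delta> m / L \<le> profile N \<Delta> m'" using pos by (simp add: field_simps)
    then have h1: "N / (N + 2) * (profile N \<Delta> m / L) \<le> N / (N + 2) * profile N \<Delta> m'"
      using pos by (intro mult_left_mono) auto
    have h2: "K * u powr (q - 1) \<le> u powr (q - 1) * (1 - u) powr (r - 1)"
      using powr_le_on_half(2)[of "1 - u" "r - 1"] u
      by (subst mult.commute, intro mult_left_mono) (auto simp: K_def)
    have "N / (N + 2) * (profile N \<Delta> m / L) * (K * u powr (q - 1))
        \<le> N / (N + 2) * profile N \<Delta> m' * (u powr (q - 1) * (1 - u) powr (r - 1))"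
      using pos profile_nonneg[of m \<Delta> N] m \<Delta> N by (intro mult_mono'[OF h1 h2]) simp_all
    then have "ennreal (c * profile N \<Delta> m * u powr (q - 1))
        \<le> ennreal (N / (N + 2) * profile N \<Delta> m' * (u powr (q - 1) * (1 - u) powr (r - 1)))"
      unfolding c_def by (intro ennreal_leI) (simp add: mult_ac)
    also have "\<dots> = ennreal (N / (N + 2) * profile N \<Delta> m') * ennreal (u powr (q - 1) * (1 - u) powr (r - 1))"
      using u by (intro ennreal_mult'') simp
    also have "\<dots> \<le> (epowr m' (- N) - epowr (m' + D) (- N)) * ennreal (u powr (q - 1) * (1 - u) powr (r - 1))"
      using epowr_diff_bounds(1)[OF N m'(1) \<Delta>] by (intro mult_right_mono) auto
    finally show "ennreal (c * profile N \<Delta> m * u powr (q - 1))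
     \<le> (epowr ((1 - u) * a + u * b) (- N) - epowr ((1 - u) * a + u * b + D) (- N))
        * ennreal (u powr (q - 1) * (1 - u) powr (r - 1))" by (simp only: m'_def)
  next
    show "c > 0" unfolding c_def using pos N by (intro mult_pos_pos divide_pos_pos) auto
  qed
qed

text \<open>The range \<open>u \<le> m / (2 b)\<close> alone suffices: there the point of the segment is at most \<open>2 m\<close>, and the weight
\<open>u^(q-1)\<close> has mass of order \<open>(m / b)^q\<close>.\<close>
lemma segment_integral_lower_point:
  "\<exists>c>0. \<forall>\<Delta> D a b m. admissible \<Delta> D a b \<longrightarrow> 0 < m \<longrightarrow> a \<le> m \<longrightarrow> m \<le> b \<longrightarrow>
     ennreal (c * b powr (- q) * (m powr q * profile N \<Delta> m)) \<le> segment_integral q r N D a b"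
proof -
  obtain c where c: "c > 0" and low: "\<And>\<Delta> D a b m u. admissible \<Delta> D a b \<Longrightarrow> 0 < u \<Longrightarrow> u \<le> 1/2 \<Longrightarrow>
      0 < m \<Longrightarrow> a + u * b \<le> 2 * m \<Longrightarrow>
     ennreal (c * profile N \<Delta> m * u powr (q - 1))
     \<le> (epowr ((1 - u) * a + u * b) (- N) - epowr ((1 - u) * a + u * b + D) (- N))
        * ennreal (u powr (q - 1) * (1 - u) powr (r - 1))"
    using segment_integrand_lower by blast
  define c' where "c' = c * 2 powr (- q) / q"
  show ?thesis
  proof (intro exI[of _ c'] conjI allI impI)
    fix \<Delta> D a b m :: real
    assume adm: "admissible \<Delta> D a b" and m: "0 < m" "a \<le> m" "m \<le> b"
    then have \<Delta>: "\<Delta> > 0" and ab: "0 \<le> a" "a \<le> b" "0 < b"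
      by (auto simp: admissible_def)
    have P: "profile N \<Delta> m \<ge> 0" using m \<Delta> by (rule_tac profile_nonneg)
    define t where "t = m / (2 * b)"
    have t: "0 < t" "t \<le> 1/2" using m ab by (auto simp: t_def field_simps)
    have "c' * b powr (- q) * (m powr q * profile N \<Delta> m) = c * profile N \<Delta> m * (t powr q / q)"
      using m ab by (simp add: c'_def t_def powr_divide powr_mult powr_minus field_simps)
    then have "ennreal (c' * b powr (- q) * (m powr q * profile N \<Delta> m)) =
        ennreal (c * profile N \<Delta> m) * (\<integral>\<^sup>+u\<in>{0..t}. ennreal (u powr (q - 1)) \<partial>lborel)"
      using nn_integral_powr_from_0[OF q, of t] t c P by (simp add: ennreal_mult'[symmetric])
    also have "\<dots> = (\<integral>\<^sup>+u. ennreal (c * profile N \<Delta> m) * (ennreal (u powr (q - 1)) * indicator {0..t} u) \<partial>lborel)"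
      by (subst nn_integral_cmult) auto
    also have "\<dots> \<le> segment_integral q r N D a b"
      unfolding segment_integral_def
    proof (intro nn_integral_mono)
      fix u :: real
      show "ennreal (c * profile N \<Delta> m) * (ennreal (u powr (q - 1)) * indicator {0..t} u)
        \<le> (epowr ((1 - u) * a + u * b) (- N) - epowr ((1 - u) * a + u * b + D) (- N))
          * ennreal (u powr (q - 1) * (1 - u) powr (r - 1)) * indicator {0<..<1} u"
      proof (cases "0 < u \<and> u \<le> t")
        case True
        have "u * b \<le> t * b" using True ab by (intro mult_right_mono) auto
        also have "t * b \<le> m" using ab m by (simp add: t_def)
        finally have "a + u * b \<le> 2 * m" using m by linarith
        from low[OF adm _ _ m(1) this] True t c P show ?thesis by (simp add: ennreal_mult')
      qed (auto simp: indicator_def)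
    qed
    finally show "ennreal (c' * b powr (- q) * (m powr q * profile N \<Delta> m)) \<le> segment_integral q r N D a b" .
  qed (use c q in \<open>simp add: c'_def\<close>)
qed

text \<open>For \<open>v = b u \<ge> a\<close> the point of the segment is at most \<open>2 v\<close>. The condition \<open>s \<le> b / 2\<close> stays
away from \<open>u = 1\<close>, where the weight may vanish.\<close>
lemma segment_integral_lower_range:
  "\<exists>c>0. \<forall>\<Delta> D a b l s. admissible \<Delta> D a b \<longrightarrow> 0 < l \<longrightarrow> a \<le> l \<longrightarrow> s \<le> b / 2 \<longrightarrow>
     ennreal (c * b powr (- q)) * (\<integral>\<^sup>+v\<in>{l..s}. ennreal (v powr (q - 1) * profile N \<Delta> v) \<partial>lborel)
     \<le> segment_integral q r N D a b"
proof -
  obtain c where c: "c > 0" and low: "\<And>\<Delta> D a b m u. admissible \<Delta> D a b \<Longrightarrow> 0 < u \<Longrightarrow> u \<le> 1/2 \<Longrightarrow>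
      0 < m \<Longrightarrow> a + u * b \<le> 2 * m \<Longrightarrow>
     ennreal (c * profile N \<Delta> m * u powr (q - 1))
     \<le> (epowr ((1 - u) * a + u * b) (- N) - epowr ((1 - u) * a + u * b + D) (- N))
        * ennreal (u powr (q - 1) * (1 - u) powr (r - 1))"
    using segment_integrand_lower by blast
  show ?thesis
  proof (intro exI[of _ c] conjI allI impI)
    fix \<Delta> D a b l s :: real
    assume adm: "admissible \<Delta> D a b" and l: "0 < l" "a \<le> l" "s \<le> b / 2"
    then have \<Delta>: "\<Delta> > 0" and ab: "0 \<le> a" "a \<le> b" "0 < b"
      by (auto simp: admissible_def)
    let ?h = "\<lambda>v. ennreal (v powr (q - 1) * profile N \<Delta> v) * indicator {l..s} v"
    have "ennreal (c * b powr (- q)) * (\<integral>\<^sup>+v. ?h v \<partial>lborel)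
        = ennreal (c * b powr (- q)) * (ennreal b * (\<integral>\<^sup>+u. ?h (b * u) \<partial>lborel))"
      using nn_integral_real_affine[of ?h b 0] ab by simp
    also have "\<dots> = ennreal (c * b powr (- q) * b) * (\<integral>\<^sup>+u. ?h (b * u) \<partial>lborel)"
      using c ab by (simp add: ennreal_mult' mult.assoc)
    also have "c * b powr (- q) * b = c * b powr (1 - q)"
      using ab by (simp add: powr_diff powr_minus field_simps)
    also have "ennreal \<dots> * (\<integral>\<^sup>+u. ?h (b * u) \<partial>lborel) = (\<integral>\<^sup>+u. ennreal (c * b powr (1 - q)) * ?h (b * u) \<partial>lborel)"
      by (subst nn_integral_cmult) auto
    also have "\<dots> \<le> segment_integral q r N D a b"
      unfolding segment_integral_def
    proof (intro nn_integral_mono)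
      fix u :: real
      show "ennreal (c * b powr (1 - q)) * ?h (b * u)
        \<le> (epowr ((1 - u) * a + u * b) (- N) - epowr ((1 - u) * a + u * b + D) (- N))
          * ennreal (u powr (q - 1) * (1 - u) powr (r - 1)) * indicator {0<..<1} u"
      proof (cases "b * u \<in> {l..s}")
        case True
        then have "0 < b * u" "b * u \<le> b / 2" using l unfolding atLeastAtMost_iff by linarith+
        then have u: "0 < u" "u \<le> 1/2"
          using mult_le_cancel_left_pos[of b u "1/2"] zero_less_mult_pos[of b u] ab by linarith+
        have P: "profile N \<Delta> (b * u) \<ge> 0" using \<open>0 < b * u\<close> \<Delta> by (rule profile_nonneg)
        have "a + u * b \<le> 2 * (b * u)" using True l by (simp add: mult.commute)
        note le = low[OF adm u \<open>0 < b * u\<close> this]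
        have "ennreal (c * b powr (1 - q)) * ?h (b * u)
            = ennreal (c * b powr (1 - q) * ((b * u) powr (q - 1) * profile N \<Delta> (b * u)))"
          using True c by (simp add: ennreal_mult'[symmetric])
        also have "c * b powr (1 - q) * ((b * u) powr (q - 1) * profile N \<Delta> (b * u))
            = c * profile N \<Delta> (b * u) * u powr (q - 1)"
          using ab u by (simp add: powr_mult powr_diff mult_ac)
        finally have "ennreal (c * b powr (1 - q)) * ?h (b * u) = ennreal (c * profile N \<Delta> (b * u) * u powr (q - 1))" .
        with le u show ?thesis by simp
      qed simp
    qed
    finally show "ennreal (c * b powr (- q)) * (\<integral>\<^sup>+v. ?h v \<partial>lborel) \<le> segment_integral q r N D a b" .
  qed (use c in simp)
qed

end

section \<open>The size of the segment integral\<close>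

lemma nn_integral_powr_Icc:
  fixes l s e :: real
  assumes "0 < l" "l \<le> s" "e \<noteq> 0"
  shows "(\<integral>\<^sup>+v\<in>{l..s}. ennreal (v powr (e - 1)) \<partial>lborel) = ennreal ((s powr e - l powr e) / e)"
proof -
  have "(\<integral>\<^sup>+v\<in>{l..s}. ennreal (v powr (e - 1)) \<partial>lborel) = ennreal (s powr e / e - l powr e / e)"
    using assms by (intro nn_integral_FTC_Icc) (auto intro!: derivative_eq_intros)
  then show ?thesis by (simp add: diff_divide_distrib)
qed

lemma nn_integral_inverse_Icc:
  fixes l s :: real
  assumes "0 < l" "l \<le> s"
  shows "(\<integral>\<^sup>+v\<in>{l..s}. ennreal (v powr - 1) \<partial>lborel) = ennreal (ln (s / l))"
proof -
  have "(\<integral>\<^sup>+v\<in>{l..s}. ennreal (v powr - 1) \<partial>lborel) = ennreal (ln s - ln l)"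
    using assms by (intro nn_integral_FTC_Icc) (auto intro!: derivative_eq_intros simp: powr_minus_divide)
  then show ?thesis using assms by (simp add: ln_div)
qed

text \<open>Dropping the value at the upper end leaves a bound uniform in \<open>s\<close>.\<close>
lemma nn_integral_powr_tail_le:
  fixes l s e :: real
  assumes "0 < l" "l \<le> s" "e > 0"
  shows "(\<integral>\<^sup>+v\<in>{l..s}. ennreal (v powr (- e - 1)) \<partial>lborel) \<le> ennreal (l powr (- e) / e)"
proof -
  have "(s powr (- e) - l powr (- e)) / (- e) \<le> l powr (- e) / e"
    using assms by (simp add: field_simps)
  then show ?thesis using nn_integral_powr_Icc[of l s "- e"] assms by (simp add: ennreal_leI)
qed

lemma powr_mult_profile: "v powr s * profile N \<Delta> v = v powr (s - N) * min 1 (\<Delta> / v)"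
  by (simp add: profile_def powr_diff powr_minus field_simps)

lemma ennreal_eq_top_if_unbounded:
  fixes J :: ennreal
  assumes "\<And>x::real. x > 0 \<Longrightarrow> ennreal x \<le> J"
  shows "J = \<infinity>"
proof (cases J)
  case (real x)
  then have "ennreal (x + 1) \<le> ennreal x" using assms[of "x + 1"] by simp
  then show ?thesis using real by (simp add: ennreal_le_iff)
qed simp

text \<open>The upper bounds produce logarithms of \<open>b\<close>, the final estimates contain \<open>(b - a) / 4 = |x_1 y_1|\<close> instead.
This is harmless: since \<open>b \<le> max (2 a) (8 (b - a) / 4)\<close>, either the logarithm is at most \<open>ln 2\<close>, or the replacement
changes it by at most \<open>ln 8\<close>.\<close>
lemma ln_le_of_le_max:
  fixes M X Y :: real
  assumes "0 < M" "0 < X" "X \<le> max (2 * M) (8 * Y)"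
  shows "ln (X / M) \<le> 4 * max 1 (ln (Y / M))"
proof (cases "X \<le> 2 * M")
  case True
  then have "X / M \<le> 2" using assms by (simp add: field_simps)
  then have "ln (X / M) \<le> ln 2" using assms by (subst ln_le_cancel_iff) auto
  also have "ln 2 \<le> (1::real)" using ln_2_less_1 by simp
  finally show ?thesis by linarith
next
  case False
  then have "X \<le> 8 * Y" and Y: "Y > 0" using assms by (auto simp: le_max_iff_disj)
  then have "X / M \<le> 8 * (Y / M)" using assms by (simp add: field_simps)
  then have "ln (X / M) \<le> ln (8 * (Y / M))" using assms Y by (subst ln_le_cancel_iff) auto
  also have "\<dots> = 3 * ln 2 + ln (Y / M)"
  proof -
    have "ln 8 = 3 * ln (2::real)" using ln_realpow[of 2 3] by simp
    then show ?thesis using assms Y by (subst ln_mult) auto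
  qed
  also have "\<dots> \<le> 4 * max 1 (ln (Y / M))" using ln_2_less_1 by linarith
  finally show ?thesis .
qed

text \<open>The constants may depend on the exponents only. Infinite values are allowed on both sides, hence also
\<open>a = b = 0\<close>.\<close>
definition segment_estimate :: "real \<Rightarrow> real \<Rightarrow> real \<Rightarrow> (real \<Rightarrow> real \<Rightarrow> real \<Rightarrow> ennreal) \<Rightarrow> bool" where
  "segment_estimate q r N F \<longleftrightarrow>
     (\<exists>c>0. \<exists>C>0. \<forall>\<Delta> D a b. 0 < \<Delta> \<longrightarrow> \<Delta> \<le> D \<longrightarrow> D \<le> 4 * \<Delta> \<longrightarrow> 0 \<le> a \<longrightarrow> a \<le> b \<longrightarrow>
        ennreal c * F \<Delta> a b \<le> segment_integral q r N D a b \<and>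
        segment_integral q r N D a b \<le> ennreal C * F \<Delta> a b)"

text \<open>The common form of the estimates; with \<open>b = \<Phi>^2\<close> the factor \<open>b^(-q)\<close> supplies the power of \<open>\<Phi>\<close>. The flag
\<open>pole\<close> tells whether the integral diverges for \<open>a = 0 < b\<close>.\<close>
definition scaled_size :: "real \<Rightarrow> bool \<Rightarrow> (real \<Rightarrow> real \<Rightarrow> real \<Rightarrow> real) \<Rightarrow> real \<Rightarrow> real \<Rightarrow> real \<Rightarrow> ennreal" where
  "scaled_size q pole R \<Delta> a b =
     (if b = 0 \<or> pole \<and> a = 0 then \<infinity> else ennreal (b powr (- q) * R \<Delta> a b))"

context weights
begin

text \<open>On the degenerate segment the integrand is \<open>\<infinity>\<close> times a positive weight.\<close>
lemma segment_integral_zero: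
  assumes "D > 0"
  shows "segment_integral q r N D 0 0 = \<infinity>"
proof -
  let ?w = "\<lambda>u. ennreal (u powr (q - 1) * (1 - u) powr (r - 1)) * indicator {0<..<1} u"
  have eq: "segment_integral q r N D 0 0 = (\<integral>\<^sup>+u. \<infinity> * ?w u \<partial>lborel)"
    using assms N unfolding segment_integral_def
    by (intro nn_integral_cong) (auto simp: epowr_def indicator_def ennreal_top_minus)
  also have "\<dots> = \<infinity> * (\<integral>\<^sup>+u. ?w u \<partial>lborel)"
    by (rule nn_integral_cmult) measurable
  also have "(\<integral>\<^sup>+u. ?w u \<partial>lborel) \<noteq> 0"
  proof
    assume "(\<integral>\<^sup>+u. ?w u \<partial>lborel) = 0"
    then have "emeasure lborel {u \<in> space lborel. ?w u \<noteq> 0} = 0"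
      by (subst (asm) nn_integral_0_iff) auto
    moreover have "{u \<in> space lborel. ?w u \<noteq> 0} = {0<..<1}"
      by (auto simp: indicator_def mult_pos_pos split: if_splits)
    ultimately have "emeasure lborel {0<..<1::real} = 0" by simp
    then show False by simp
  qed
  then have "\<infinity> * (\<integral>\<^sup>+u. ?w u \<partial>lborel) = \<infinity>" by (simp add: ennreal_top_mult)
  finally show ?thesis .
qed

lemma segment_integral_le:
  "\<exists>C>0. \<forall>\<Delta> D a b F. admissible \<Delta> D a b \<longrightarrow>
     b powr (q - N) * min 1 (\<Delta> / b) \<le> F \<longrightarrow> a powr (q - N) * min 1 (\<Delta> / a) \<le> F \<longrightarrow>
     (\<integral>\<^sup>+v\<in>{a..b}. ennreal (v powr (q - N - 1) * min 1 (\<Delta> / v)) \<partial>lborel) \<le> ennreal F \<longrightarrow>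
     segment_integral q r N D a b \<le> ennreal (C * (b powr (- q) * F))"
proof -
  obtain C where C: "C > 0" and up: "\<And>\<Delta> D a b. admissible \<Delta> D a b \<Longrightarrow>
     segment_integral q r N D a b \<le> ennreal (C * b powr (- q)) *
       (ennreal (b powr q * profile N \<Delta> b) + ennreal (a powr q * profile N \<Delta> a)
        + (\<integral>\<^sup>+v\<in>{a..b}. ennreal (v powr (q - 1) * profile N \<Delta> v) \<partial>lborel))"
    using segment_integral_upper by blast
  show ?thesis
  proof (intro exI[of _ "3 * C"] conjI allI impI)
    fix \<Delta> D a b F :: real
    assume adm: "admissible \<Delta> D a b"
      and F: "b powr (q - N) * min 1 (\<Delta> / b) \<le> F" "a powr (q - N) * min 1 (\<Delta> / a) \<le> F"
        "(\<integral>\<^sup>+v\<in>{a..b}. ennreal (v powr (q - N - 1) * min 1 (\<Delta> / v)) \<partial>lborel) \<le> ennreal F"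
    have "0 \<le> b powr (q - N) * min 1 (\<Delta> / b)" using adm by (auto simp: admissible_def)
    then have F0: "F \<ge> 0" using F by linarith
    have "q - 1 - N = q - N - 1" by simp
    note up[OF adm, unfolded powr_mult_profile this]
    also have "ennreal (C * b powr (- q)) *
       (ennreal (b powr (q - N) * min 1 (\<Delta> / b)) + ennreal (a powr (q - N) * min 1 (\<Delta> / a))
        + (\<integral>\<^sup>+v\<in>{a..b}. ennreal (v powr (q - N - 1) * min 1 (\<Delta> / v)) \<partial>lborel))
       \<le> ennreal (C * b powr (- q)) * (ennreal F + ennreal F + ennreal F)"
      using F by (intro mult_left_mono add_mono ennreal_leI) auto
    also have "ennreal F + ennreal F + ennreal F = ennreal (3 * F)"
      using F0 by (simp flip: ennreal_plus)
    also have "ennreal (C * b powr (- q)) * ennreal (3 * F) = ennreal (3 * C * (b powr (- q) * F))"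
      using F0 C by (simp flip: ennreal_mult' add: mult_ac)
    finally show "segment_integral q r N D a b \<le> ennreal (3 * C * (b powr (- q) * F))" .
  qed (use C in simp)
qed

lemma segment_integral_ge_point:
  "\<exists>c>0. \<forall>\<Delta> D a b m. admissible \<Delta> D a b \<longrightarrow> 0 < m \<longrightarrow> a \<le> m \<longrightarrow> m \<le> b \<longrightarrow>
     ennreal (c * (b powr (- q) * (m powr (q - N) * min 1 (\<Delta> / m)))) \<le> segment_integral q r N D a b"
  using segment_integral_lower_point unfolding powr_mult_profile mult.assoc .

text \<open>An integrand bounded below by \<open>\<kappa> / v\<close> contributes \<open>\<kappa> ln (s / l)\<close>: this is where logarithms enter the lower bounds.\<close>
lemma segment_integral_ge_log:
  "\<exists>c>0. \<forall>\<Delta> D a b l s \<kappa>. admissible \<Delta> D a b \<longrightarrow> 0 < l \<longrightarrow> a \<le> l \<longrightarrow> l \<le> s \<longrightarrow> s \<le> b / 2 \<longrightarrow> 0 \<le> \<kappa> \<longrightarrow>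
     (\<forall>v\<in>{l..s}. \<kappa> / v \<le> v powr (q - N - 1) * min 1 (\<Delta> / v)) \<longrightarrow>
     ennreal (c * (b powr (- q) * (\<kappa> * ln (s / l)))) \<le> segment_integral q r N D a b"
proof -
  obtain c where c: "c > 0" and low: "\<And>\<Delta> D a b l s. admissible \<Delta> D a b \<Longrightarrow> 0 < l \<Longrightarrow> a \<le> l \<Longrightarrow> s \<le> b / 2 \<Longrightarrow>
     ennreal (c * b powr (- q)) * (\<integral>\<^sup>+v\<in>{l..s}. ennreal (v powr (q - 1) * profile N \<Delta> v) \<partial>lborel)
     \<le> segment_integral q r N D a b"
    using segment_integral_lower_range by blast
  show ?thesis
  proof (intro exI[of _ c] conjI allI impI)
    fix \<Delta> D a b l s \<kappa> :: real
    assume adm: "admissible \<Delta> D a b" and l: "0 < l" "a \<le> l" "l \<le> s" "s \<le> b / 2" and \<kappa>: "0 \<le> \<kappa>"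
      and le: "\<forall>v\<in>{l..s}. \<kappa> / v \<le> v powr (q - N - 1) * min 1 (\<Delta> / v)"
    have "ennreal (c * (b powr (- q) * (\<kappa> * ln (s / l)))) = ennreal (c * b powr (- q)) * (ennreal \<kappa> * ennreal (ln (s / l)))"
      using c \<kappa> l by (simp add: ennreal_mult mult_ac)
    also have "ennreal \<kappa> * ennreal (ln (s / l)) = (\<integral>\<^sup>+v. ennreal \<kappa> * (ennreal (v powr - 1) * indicator {l..s} v) \<partial>lborel)"
      using nn_integral_inverse_Icc[of l s] l by (subst nn_integral_cmult) auto
    also have "\<dots> \<le> (\<integral>\<^sup>+v\<in>{l..s}. ennreal (v powr (q - 1) * profile N \<Delta> v) \<partial>lborel)"
    proof (intro nn_integral_mono)
      fix v
      have eq: "v powr (q - 1) * profile N \<Delta> v = v powr (q - N - 1) * min 1 (\<Delta> / v)"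
      proof -
        have "q - 1 - N = q - N - 1" by simp
        then show ?thesis by (simp only: powr_mult_profile)
      qed
      have "ennreal \<kappa> * ennreal (v powr - 1) = ennreal (\<kappa> / v)" if "v \<in> {l..s}"
        using \<kappa> l that by (simp flip: ennreal_mult' add: powr_minus_divide)
      then show "ennreal \<kappa> * (ennreal (v powr - 1) * indicator {l..s} v)
          \<le> ennreal (v powr (q - 1) * profile N \<Delta> v) * indicator {l..s} v"
        unfolding eq using le by (cases "v \<in> {l..s}") (auto intro!: ennreal_leI)
    qed
    also have "ennreal (c * b powr (- q)) * \<dots> \<le> segment_integral q r N D a b"
      using low adm l by blast
    finally show "ennreal (c * (b powr (- q) * (\<kappa> * ln (s / l)))) \<le> segment_integral q r N D a b"
      by (simp add: mult_left_mono)
  qed (use c in simp)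
qed

lemma segment_estimateI:
  assumes "\<exists>c>0. \<forall>\<Delta> D a b. admissible \<Delta> D a b \<longrightarrow> ennreal c * F \<Delta> a b \<le> segment_integral q r N D a b"
    and "\<exists>C>0. \<forall>\<Delta> D a b. admissible \<Delta> D a b \<longrightarrow> segment_integral q r N D a b \<le> ennreal C * F \<Delta> a b"
    and zero: "\<And>\<Delta>. F \<Delta> 0 0 = \<infinity>"
  shows "segment_estimate q r N F"
proof -
  obtain c where c: "c > 0" "\<And>\<Delta> D a b. admissible \<Delta> D a b \<Longrightarrow> ennreal c * F \<Delta> a b \<le> segment_integral q r N D a b"
    using assms(1) by blast
  obtain C where C: "C > 0" "\<And>\<Delta> D a b. admissible \<Delta> D a b \<Longrightarrow> segment_integral q r N D a b \<le> ennreal C * F \<Delta> a b"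
    using assms(2) by blast
  show ?thesis
    unfolding segment_estimate_def
  proof (rule exI[of _ c], rule conjI[OF c(1)], rule exI[of _ C], rule conjI[OF C(1)], intro allI impI)
    fix \<Delta> D a b :: real
    assume *: "0 < \<Delta>" "\<Delta> \<le> D" "D \<le> 4 * \<Delta>" "0 \<le> a" "a \<le> b"
    show "ennreal c * F \<Delta> a b \<le> segment_integral q r N D a b \<and> segment_integral q r N D a b \<le> ennreal C * F \<Delta> a b"
    proof (cases "b = 0")
      case True
      then have "a = 0" "b = 0" using * by auto
      then show ?thesis using segment_integral_zero[of D] zero C(1) * by (simp add: ennreal_mult_top)
    next
      case False
      then have "admissible \<Delta> D a b" using * by (simp add: admissible_def)
      then show ?thesis using c C by blast
    qed
  qed
qed

text \<open>Splits an estimate into its finite part, where the three terms of \<open>segment_integral_le\<close> are compared with \<open>R\<close>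
by real inequalities, and the divergence for \<open>a = 0\<close>.\<close>
lemma segment_estimate_realI:
  fixes R :: "real \<Rightarrow> real \<Rightarrow> real \<Rightarrow> real" and pole :: bool and L :: real
  assumes nonneg: "\<And>\<Delta> D a b. admissible \<Delta> D a b \<Longrightarrow> \<not> (pole \<and> a = 0) \<Longrightarrow> 0 \<le> R \<Delta> a b"
    and infinite: "\<And>\<Delta> D b. pole \<Longrightarrow> admissible \<Delta> D 0 b \<Longrightarrow> segment_integral q r N D 0 b = \<infinity>"
    and lower: "\<exists>c>0. \<forall>\<Delta> D a b. admissible \<Delta> D a b \<longrightarrow> \<not> (pole \<and> a = 0) \<longrightarrow>
        ennreal (c * (b powr (- q) * R \<Delta> a b)) \<le> segment_integral q r N D a b"
    and L: "L \<ge> 1"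
    and upper: "\<And>\<Delta> D a b. admissible \<Delta> D a b \<Longrightarrow> \<not> (pole \<and> a = 0) \<Longrightarrow>
        b powr (q - N) * min 1 (\<Delta> / b) \<le> R \<Delta> a b \<and>
        a powr (q - N) * min 1 (\<Delta> / a) \<le> R \<Delta> a b \<and>
        (\<integral>\<^sup>+v\<in>{a..b}. ennreal (v powr (q - N - 1) * min 1 (\<Delta> / v)) \<partial>lborel) \<le> ennreal (L * R \<Delta> a b)"
  shows "segment_estimate q r N (scaled_size q pole R)"
  unfolding scaled_size_def
proof (rule segment_estimateI)
  obtain c where c: "c > 0" and low: "\<And>\<Delta> D a b. admissible \<Delta> D a b \<Longrightarrow> \<not> (pole \<and> a = 0) \<Longrightarrow>
     ennreal (c * (b powr (- q) * R \<Delta> a b)) \<le> segment_integral q r N D a b"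
    using lower by blast
  show "\<exists>c>0. \<forall>\<Delta> D a b. admissible \<Delta> D a b \<longrightarrow> ennreal c *
      (if b = 0 \<or> pole \<and> a = 0 then \<infinity> else ennreal (b powr (- q) * R \<Delta> a b)) \<le> segment_integral q r N D a b"
  proof (rule exI[of _ c], rule conjI[OF c], intro allI impI)
    fix \<Delta> D a b :: real assume adm: "admissible \<Delta> D a b"
    then have "b \<noteq> 0" by (simp add: admissible_def)
    then show "ennreal c * (if b = 0 \<or> pole \<and> a = 0 then \<infinity> else ennreal (b powr (- q) * R \<Delta> a b))
        \<le> segment_integral q r N D a b"
      using infinite adm low[OF adm] c by (cases "pole \<and> a = 0") (auto simp: ennreal_mult')
  qed
next
  obtain C where C: "C > 0" and up: "\<And>\<Delta> D a b F. admissible \<Delta> D a b \<Longrightarrow>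
     b powr (q - N) * min 1 (\<Delta> / b) \<le> F \<Longrightarrow> a powr (q - N) * min 1 (\<Delta> / a) \<le> F \<Longrightarrow>
     (\<integral>\<^sup>+v\<in>{a..b}. ennreal (v powr (q - N - 1) * min 1 (\<Delta> / v)) \<partial>lborel) \<le> ennreal F \<Longrightarrow>
     segment_integral q r N D a b \<le> ennreal (C * (b powr (- q) * F))"
    using segment_integral_le by blast
  have CL: "C * L > 0" using C L by simp
  show "\<exists>C>0. \<forall>\<Delta> D a b. admissible \<Delta> D a b \<longrightarrow> segment_integral q r N D a b \<le> ennreal C *
      (if b = 0 \<or> pole \<and> a = 0 then \<infinity> else ennreal (b powr (- q) * R \<Delta> a b))"
  proof (rule exI[of _ "C * L"], rule conjI[OF CL], intro allI impI)
    fix \<Delta> D a b :: real assume adm: "admissible \<Delta> D a b"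
    show "segment_integral q r N D a b \<le> ennreal (C * L) *
      (if b = 0 \<or> pole \<and> a = 0 then \<infinity> else ennreal (b powr (- q) * R \<Delta> a b))"
    proof (cases "pole \<and> a = 0")
      case True
      then show ?thesis using CL by (simp add: ennreal_mult_top del: ennreal_mult_eq_top_iff) auto
    next
      case False
      have R0: "0 \<le> R \<Delta> a b" by (rule nonneg[OF adm False])
      then have "R \<Delta> a b \<le> L * R \<Delta> a b" using L by (simp add: mult_le_cancel_right1)
      with upper[OF adm False]
      have "segment_integral q r N D a b \<le> ennreal (C * (b powr (- q) * (L * R \<Delta> a b)))"
        by (intro up[OF adm]) auto
      also have "C * (b powr (- q) * (L * R \<Delta> a b)) = C * L * (b powr (- q) * R \<Delta> a b)" by simp
      also have "ennreal \<dots> = ennreal (C * L) * ennreal (b powr (- q) * R \<Delta> a b)"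
        using R0 by (intro ennreal_mult'') simp
      finally show ?thesis using False adm by (simp only: admissible_def if_False) simp
    qed
  qed
qed simp

text \<open>Since \<open>q - N\<close> is negative, \<open>v^(q-N-1)\<close> is integrable at infinity. Hence all terms of the upper bound are
dominated by the one at \<open>a\<close>, which is also the lower bound for \<open>m = a\<close>. For \<open>a = 0\<close> the lower bounds
with \<open>m \<rightarrow> 0\<close> are unbounded.\<close>
lemma segment_estimate_power:
  assumes e: "N > q"
  shows "segment_estimate q r N (scaled_size q True (\<lambda>\<Delta> a b. a powr (q - N) * min 1 (\<Delta> / a)))"
proof (rule segment_estimate_realI)
  obtain c where c: "c > 0" and low: "\<And>\<Delta> D a b m. admissible \<Delta> D a b \<Longrightarrow> 0 < m \<Longrightarrow> a \<le> m \<Longrightarrow> m \<le> b \<Longrightarrow>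
     ennreal (c * (b powr (- q) * (m powr (q - N) * min 1 (\<Delta> / m)))) \<le> segment_integral q r N D a b"
    using segment_integral_ge_point by blast
  show "\<exists>c>0. \<forall>\<Delta> D a b. admissible \<Delta> D a b \<longrightarrow> \<not> (True \<and> a = 0) \<longrightarrow>
      ennreal (c * (b powr (- q) * (a powr (q - N) * min 1 (\<Delta> / a)))) \<le> segment_integral q r N D a b"
    using c low by (auto simp: admissible_def intro!: exI[of _ c])
  fix \<Delta> D b assume adm: "admissible \<Delta> D 0 b"
  then have \<Delta>: "\<Delta> > 0" and b: "0 < b" by (auto simp: admissible_def)
  show "segment_integral q r N D 0 b = \<infinity>"
  proof (rule ennreal_eq_top_if_unbounded)
    fix x :: real assume x: "x > 0"
    define y where "y = x / (c * b powr (- q))"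
    \<comment> \<open>Chosen so that \<open>min 1 (\<Delta> / m) = 1\<close> and \<open>m^(q-N) \<ge> y\<close>.\<close>
    define m where "m = min (min b \<Delta>) (y powr (1 / (q - N)))"
    have y: "y > 0" using x c b by (simp add: y_def)
    have m: "0 < m" "m \<le> b" "m \<le> \<Delta>" "m \<le> y powr (1 / (q - N))"
      using b \<Delta> y by (auto simp: m_def)
    have "y = (y powr (1 / (q - N))) powr (q - N)" using y e by (simp add: powr_powr)
    also have "\<dots> \<le> m powr (q - N)" using m e by (intro powr_mono2') auto
    finally have "x \<le> c * (b powr (- q) * (m powr (q - N) * min 1 (\<Delta> / m)))"
      using c b m by (simp add: y_def field_simps)
    then show "ennreal x \<le> segment_integral q r N D 0 b"
      using low[OF adm, of m] m by (meson ennreal_leI less_imp_le order_trans)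
  qed
next
  fix \<Delta> D a b assume adm: "admissible \<Delta> D a b" and "\<not> (True \<and> a = 0)"
  then have \<Delta>: "\<Delta> > 0" and ab: "0 < a" "a \<le> b" "0 < b" by (auto simp: admissible_def)
  show "0 \<le> a powr (q - N) * min 1 (\<Delta> / a)" using ab \<Delta> by simp
  have mn: "min 1 (\<Delta> / v) \<le> min 1 (\<Delta> / a)" if "a \<le> v" for v
    using that ab \<Delta> by (intro min.mono divide_left_mono) auto
  have "(\<integral>\<^sup>+v\<in>{a..b}. ennreal (v powr (q - N - 1) * min 1 (\<Delta> / v)) \<partial>lborel)
     \<le> (\<integral>\<^sup>+v. ennreal (min 1 (\<Delta> / a)) * (ennreal (v powr (- (N - q) - 1)) * indicator {a..b} v) \<partial>lborel)"
  proof (intro nn_integral_mono)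
    fix v
    show "ennreal (v powr (q - N - 1) * min 1 (\<Delta> / v)) * indicator {a..b} v
      \<le> ennreal (min 1 (\<Delta> / a)) * (ennreal (v powr (- (N - q) - 1)) * indicator {a..b} v)"
      using mn[of v] ab \<Delta> by (cases "v \<in> {a..b}")
        (auto simp flip: ennreal_mult'' simp: mult.commute intro!: ennreal_leI mult_left_mono)
  qed
  also have "\<dots> = ennreal (min 1 (\<Delta> / a)) * (\<integral>\<^sup>+v\<in>{a..b}. ennreal (v powr (- (N - q) - 1)) \<partial>lborel)"
    by (rule nn_integral_cmult) measurable
  also have "\<dots> \<le> ennreal (min 1 (\<Delta> / a)) * ennreal (a powr (- (N - q)) / (N - q))"
    using ab e by (intro mult_left_mono nn_integral_powr_tail_le) auto
  also have "\<dots> = ennreal (1 / (N - q) * (a powr (q - N) * min 1 (\<Delta> / a)))"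
    using e ab \<Delta> by (simp flip: ennreal_mult'' add: mult_ac)
  also have "\<dots> \<le> ennreal ((1 + 1 / (N - q)) * (a powr (q - N) * min 1 (\<Delta> / a)))"
    using ab \<Delta> by (intro ennreal_leI mult_right_mono) auto
  finally show "b powr (q - N) * min 1 (\<Delta> / b) \<le> a powr (q - N) * min 1 (\<Delta> / a) \<and>
      a powr (q - N) * min 1 (\<Delta> / a) \<le> a powr (q - N) * min 1 (\<Delta> / a) \<and>
      (\<integral>\<^sup>+v\<in>{a..b}. ennreal (v powr (q - N - 1) * min 1 (\<Delta> / v)) \<partial>lborel)
      \<le> ennreal ((1 + 1 / (N - q)) * (a powr (q - N) * min 1 (\<Delta> / a)))"
    using ab e \<Delta> mn[of b] by (auto intro!: mult_mono powr_mono2')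
qed (use e in auto)

text \<open>Uses \<open>min 1 (\<Delta> / v) \<le> 1\<close> below \<open>s\<close> and \<open>min 1 (\<Delta> / v) \<le> \<Delta> / v\<close> above \<open>l\<close>. Either range may be
empty; in the applications the split is at \<open>\<Delta>\<close>, moved to an end of the interval if \<open>\<Delta>\<close> lies outside.\<close>
lemma profile_integral_le:
  assumes "0 < \<Delta>" "0 < l"
    and 1: "\<And>v. a \<le> v \<Longrightarrow> v \<le> b \<Longrightarrow> v \<le> s \<or> l \<le> v"
  shows "(\<integral>\<^sup>+v\<in>{a..b}. ennreal (v powr (p - 1) * min 1 (\<Delta> / v)) \<partial>lborel)
     \<le> (\<integral>\<^sup>+v\<in>{a..s}. ennreal (v powr (p - 1)) \<partial>lborel) + ennreal \<Delta> * (\<integral>\<^sup>+v\<in>{l..b}. ennreal (v powr (p - 2)) \<partial>lborel)"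
proof -
  have "(\<integral>\<^sup>+v\<in>{a..b}. ennreal (v powr (p - 1) * min 1 (\<Delta> / v)) \<partial>lborel)
     \<le> (\<integral>\<^sup>+v. ennreal (v powr (p - 1)) * indicator {a..s} v
            + ennreal \<Delta> * (ennreal (v powr (p - 2)) * indicator {l..b} v) \<partial>lborel)"
  proof (intro nn_integral_mono)
    fix v
    show "ennreal (v powr (p - 1) * min 1 (\<Delta> / v)) * indicator {a..b} v
      \<le> ennreal (v powr (p - 1)) * indicator {a..s} v
            + ennreal \<Delta> * (ennreal (v powr (p - 2)) * indicator {l..b} v)"
    proof (cases "v \<in> {a..b}")
      case True
      with 1 consider "v \<in> {a..s}" | "v \<in> {l..b}" by fastforce
      then show ?thesis
      proof cases
        case 1
        have "v powr (p - 1) * min 1 (\<Delta> / v) \<le> v powr (p - 1)"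
          using mult_left_mono[of "min 1 (\<Delta> / v)" 1 "v powr (p - 1)"] by simp
        then show ?thesis using 1 True by (auto intro: add_increasing2 ennreal_leI)
      next
        case 2
        then have v: "v > 0" using assms by simp
        have "v powr (p - 1) * min 1 (\<Delta> / v) \<le> v powr (p - 1) * (\<Delta> / v)"
          by (intro mult_left_mono) auto
        also have "\<dots> = \<Delta> * v powr (p - 2)"
          using v by (simp add: powr_diff power2_eq_square)
        finally show ?thesis using 2 True assms
          by (auto simp flip: ennreal_mult'' intro!: add_increasing ennreal_leI)
      qed
    qed simp
  qed
  also have "\<dots> = (\<integral>\<^sup>+v\<in>{a..s}. ennreal (v powr (p - 1)) \<partial>lborel) + ennreal \<Delta> * (\<integral>\<^sup>+v\<in>{l..b}. ennreal (v powr (p - 2)) \<partial>lborel)"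
    by (subst nn_integral_add, measurable, subst nn_integral_cmult, measurable)
  finally show ?thesis .
qed

text \<open>Here the integrand is \<open>1 / v\<close> up to \<open>\<Delta>\<close> and \<open>\<Delta> / v^2\<close> beyond, so the integral is
\<open>ln (min b \<Delta> / a) + O(1)\<close> if \<open>a < \<Delta>\<close> and at most \<open>\<Delta> / a\<close> otherwise. Two lower bounds are combined: the point
\<open>m = a\<close> when the logarithm is at most \<open>1\<close>, and the range from \<open>a\<close> to \<open>min ((b - a) / 4) \<Delta>\<close> when it is larger.\<close>
lemma segment_estimate_log:
  assumes e: "N = q"
  shows "segment_estimate q r N 
           (scaled_size q True (\<lambda>\<Delta> a b. min 1 (\<Delta> / a) * max 1 (ln (min ((b - a) / 4) \<Delta> / a))))"
proof (rule segment_estimate_realI)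
  obtain c1 where c1: "c1 > 0" and low1: "\<And>\<Delta> D a b m. admissible \<Delta> D a b \<Longrightarrow> 0 < m \<Longrightarrow> a \<le> m \<Longrightarrow> m \<le> b \<Longrightarrow>
     ennreal (c1 * (b powr (- q) * (m powr (q - N) * min 1 (\<Delta> / m)))) \<le> segment_integral q r N D a b"
    using segment_integral_ge_point by blast
  obtain c2 where c2: "c2 > 0" and low2: "\<And>\<Delta> D a b l s \<kappa>. admissible \<Delta> D a b \<Longrightarrow> 0 < l \<Longrightarrow> a \<le> l \<Longrightarrow>
      l \<le> s \<Longrightarrow> s \<le> b / 2 \<Longrightarrow> 0 \<le> \<kappa> \<Longrightarrow> \<forall>v\<in>{l..s}. \<kappa> / v \<le> v powr (q - N - 1) * min 1 (\<Delta> / v) \<Longrightarrow>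
     ennreal (c2 * (b powr (- q) * (\<kappa> * ln (s / l)))) \<le> segment_integral q r N D a b"
    using segment_integral_ge_log by blast
  have low2': "ennreal (c2 * (b powr (- q) * ln (s / l))) \<le> segment_integral q r N D a b"
    if "admissible \<Delta> D a b" "0 < l" "a \<le> l" "l \<le> s" "s \<le> b / 2" "s \<le> \<Delta>" for \<Delta> D a b l s
    using low2[OF that(1-5), of 1] that e by (auto simp: powr_minus_divide)
  have c: "min c1 c2 > 0" using c1 c2 by simp
  show "\<exists>c>0. \<forall>\<Delta> D a b. admissible \<Delta> D a b \<longrightarrow> \<not> (True \<and> a = 0) \<longrightarrow>
      ennreal (c * (b powr (- q) * (min 1 (\<Delta> / a) * max 1 (ln (min ((b - a) / 4) \<Delta> / a)))))
      \<le> segment_integral q r N D a b"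
  proof (rule exI[of _ "min c1 c2"], rule conjI[OF c], intro allI impI)
    fix \<Delta> D a b assume adm: "admissible \<Delta> D a b" and "\<not> (True \<and> a = 0)"
    then have \<Delta>: "\<Delta> > 0" and ab: "0 < a" "a \<le> b" "0 < b" by (auto simp: admissible_def)
    define s where "s = min ((b - a) / 4) \<Delta>"
    have s: "s \<ge> 0" using ab \<Delta> by (simp add: s_def)
    have "ennreal (min c1 c2 * (b powr (- q) * (min 1 (\<Delta> / a) * max 1 (ln (s / a)))))
        \<le> segment_integral q r N D a b"
    proof (cases "ln (s / a) \<le> 1")
      case True
      then have "ennreal (min c1 c2 * (b powr (- q) * (min 1 (\<Delta> / a) * max 1 (ln (s / a)))))
          = ennreal (min c1 c2 * (b powr (- q) * min 1 (\<Delta> / a)))" by simp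
      also have "\<dots> \<le> ennreal (c1 * (b powr (- q) * min 1 (\<Delta> / a)))"
        using ab \<Delta> by (intro ennreal_leI mult_right_mono) auto
      also have "\<dots> \<le> segment_integral q r N D a b"
        using low1[OF adm, of a] ab e by simp
      finally show ?thesis .
    next
      case False
      have "s > a"
      proof (rule ccontr)
        assume "\<not> s > a"
        then have "s / a \<le> 1" using ab by simp
        then have "ln (s / a) \<le> 0" using s ab by (cases "s = 0") auto
        then show False using False by simp
      qed
      then have "min 1 (\<Delta> / a) = 1" using ab by (simp add: s_def)
      then have "ennreal (min c1 c2 * (b powr (- q) * (min 1 (\<Delta> / a) * max 1 (ln (s / a)))))
          = ennreal (min c1 c2 * (b powr (- q) * ln (s / a)))" using False by simp
      also have "\<dots> \<le> ennreal (c2 * (b powr (- q) * ln (s / a)))"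
        using False by (intro ennreal_leI mult_right_mono) auto
      also have "\<dots> \<le> segment_integral q r N D a b"
        using low2'[OF adm, of a s] ab \<open>s > a\<close> by (simp add: s_def min_def split: if_splits)
      finally show ?thesis .
    qed
    then show "ennreal (min c1 c2 * (b powr (- q) * (min 1 (\<Delta> / a) * max 1 (ln (min ((b - a) / 4) \<Delta> / a)))))
        \<le> segment_integral q r N D a b" by (simp only: s_def)
  qed
  fix \<Delta> D b assume adm: "admissible \<Delta> D 0 b"
  then have \<Delta>: "\<Delta> > 0" and b: "0 < b" by (auto simp: admissible_def)
  show "segment_integral q r N D 0 b = \<infinity>"
  proof (rule ennreal_eq_top_if_unbounded)
    fix x :: real assume x: "x > 0"
    define y where "y = x / (c2 * b powr (- q))"
    define s where "s = min (b / 2) \<Delta>"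
    have y: "y > 0" using x c2 b by (simp add: y_def)
    have s: "s > 0" using b \<Delta> by (simp add: s_def)
    \<comment> \<open>The range from \<open>s exp(-y)\<close> to \<open>s\<close> has logarithmic length \<open>y\<close>, which is arbitrary.\<close>
    have "ennreal (c2 * (b powr (- q) * ln (s / (s * exp (- y))))) \<le> segment_integral q r N D 0 b"
    proof (rule low2'[OF adm])
      show "s * exp (- y) \<le> s" using s y by (intro mult_left_le) auto
    qed (use s in \<open>auto simp: s_def\<close>)
    moreover have "s / (s * exp (- y)) = exp y" using s by (simp add: exp_minus field_simps)
    then have "ln (s / (s * exp (- y))) = y" by simp
    moreover have "c2 * (b powr (- q) * y) = x" using c2 b by (simp add: y_def)
    ultimately show "ennreal x \<le> segment_integral q r N D 0 b" by simp
  qed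
next
  fix \<Delta> D a b assume adm: "admissible \<Delta> D a b" and "\<not> (True \<and> a = 0)"
  then have \<Delta>: "\<Delta> > 0" and ab: "0 < a" "a \<le> b" "0 < b" by (auto simp: admissible_def)
  define F where "F = min 1 (\<Delta> / a) * max 1 (ln (min ((b - a) / 4) \<Delta> / a))"
  have "min 1 (\<Delta> / a) * 1 \<le> F"
    unfolding F_def using ab \<Delta> by (intro mult_left_mono) auto
  then have F: "min 1 (\<Delta> / a) \<le> F" by simp
  have "0 \<le> min 1 (\<Delta> / a)" using ab \<Delta> by simp
  with F show "0 \<le> min 1 (\<Delta> / a) * max 1 (ln (min ((b - a) / 4) \<Delta> / a))"
    unfolding F_def by linarith
  have mn: "min 1 (\<Delta> / b) \<le> min 1 (\<Delta> / a)"
    using ab \<Delta> by (intro min.mono divide_left_mono) auto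
  have tail: "ennreal \<Delta> * (\<integral>\<^sup>+v\<in>{l..b}. ennreal (v powr (0 - 2)) \<partial>lborel) \<le> ennreal (\<Delta> / l)"
    if "0 < l" "l \<le> b" for l
  proof -
    have "(\<integral>\<^sup>+v\<in>{l..b}. ennreal (v powr (0 - 2)) \<partial>lborel) \<le> ennreal (1 / l)"
      using nn_integral_powr_tail_le[of l b 1] that by (simp add: powr_minus_divide)
    then have "ennreal \<Delta> * (\<integral>\<^sup>+v\<in>{l..b}. ennreal (v powr (0 - 2)) \<partial>lborel) \<le> ennreal \<Delta> * ennreal (1 / l)"
      by (intro mult_left_mono) auto
    also have "\<dots> = ennreal (\<Delta> / l)" using \<Delta> by (simp flip: ennreal_mult')
    finally show ?thesis .
  qed
  have "(\<integral>\<^sup>+v\<in>{a..b}. ennreal (v powr (0 - 1) * min 1 (\<Delta> / v)) \<partial>lborel) \<le> ennreal (5 * F)"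
  proof (cases "\<Delta> \<le> a")
    case True
    have "(\<integral>\<^sup>+v\<in>{a..b}. ennreal (v powr (0 - 1) * min 1 (\<Delta> / v)) \<partial>lborel)
        \<le> (\<integral>\<^sup>+v\<in>{a..a}. ennreal (v powr (0 - 1)) \<partial>lborel) + ennreal \<Delta> * (\<integral>\<^sup>+v\<in>{a..b}. ennreal (v powr (0 - 2)) \<partial>lborel)"
      by (rule profile_integral_le) (use \<Delta> ab in auto)
    also have "(\<integral>\<^sup>+v\<in>{a..a}. ennreal (v powr (0 - 1)) \<partial>lborel) = 0"
      using nn_integral_inverse_Icc[of a a] ab by simp
    also have "0 + ennreal \<Delta> * (\<integral>\<^sup>+v\<in>{a..b}. ennreal (v powr (0 - 2)) \<partial>lborel) \<le> ennreal (\<Delta> / a)"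
      using tail[of a] ab by simp
    also have "\<dots> \<le> ennreal (5 * F)"
    proof -
      have "\<Delta> / a = min 1 (\<Delta> / a)" using True ab by simp
      moreover have "0 \<le> \<Delta> / a" using \<Delta> ab by simp
      ultimately show ?thesis using F by (intro ennreal_leI) linarith
    qed
    finally show ?thesis .
  next
    case False
    define s where "s = min b \<Delta>"
    have s: "a \<le> s" "s \<le> b" "0 < s" using False ab by (auto simp: s_def)
    have one: "min 1 (\<Delta> / a) = 1" using False ab by simp
    have rest: "ennreal \<Delta> * (\<integral>\<^sup>+v\<in>{\<Delta>..b}. ennreal (v powr (0 - 2)) \<partial>lborel) \<le> ennreal 1"
    proof (cases "\<Delta> \<le> b")
      case True
      then show ?thesis using tail[of \<Delta>] \<Delta> by simp
    qed simp
    have "s \<le> max (2 * a) (8 * min ((b - a) / 4) \<Delta>)"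
    proof (cases "b \<le> 2 * a")
      case True
      then show ?thesis by (simp add: s_def)
    next
      case False
      then have "b \<le> 8 * ((b - a) / 4)" by simp
      then have "s \<le> 8 * min ((b - a) / 4) \<Delta>" using \<Delta> by (simp add: s_def min_def)
      then show ?thesis by (rule max.coboundedI2)
    qed
    then have ln: "ln (s / a) \<le> 4 * max 1 (ln (min ((b - a) / 4) \<Delta> / a))"
      using ab s by (intro ln_le_of_le_max) auto
    have "(\<integral>\<^sup>+v\<in>{a..b}. ennreal (v powr (0 - 1) * min 1 (\<Delta> / v)) \<partial>lborel)
        \<le> (\<integral>\<^sup>+v\<in>{a..s}. ennreal (v powr (0 - 1)) \<partial>lborel) + ennreal \<Delta> * (\<integral>\<^sup>+v\<in>{\<Delta>..b}. ennreal (v powr (0 - 2)) \<partial>lborel)"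
      by (rule profile_integral_le) (use \<Delta> s in \<open>auto simp: s_def\<close>)
    also have "\<dots> \<le> ennreal (ln (s / a)) + ennreal 1"
      using nn_integral_inverse_Icc[of a s] ab s rest by (intro add_mono) auto
    also have "\<dots> = ennreal (ln (s / a) + 1)"
      using s ab by (intro ennreal_plus[symmetric]) auto
    also have "\<dots> \<le> ennreal (5 * F)"
      using ln unfolding F_def one by (intro ennreal_leI) linarith
    finally show ?thesis .
  qed
  then show "b powr (q - N) * min 1 (\<Delta> / b) \<le> min 1 (\<Delta> / a) * max 1 (ln (min ((b - a) / 4) \<Delta> / a)) \<and>
      a powr (q - N) * min 1 (\<Delta> / a) \<le> min 1 (\<Delta> / a) * max 1 (ln (min ((b - a) / 4) \<Delta> / a)) \<and>
      (\<integral>\<^sup>+v\<in>{a..b}. ennreal (v powr (q - N - 1) * min 1 (\<Delta> / v)) \<partial>lborel)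
      \<le> ennreal (5 * (min 1 (\<Delta> / a) * max 1 (ln (min ((b - a) / 4) \<Delta> / a))))"
    using F mn ab e unfolding F_def by simp
qed simp

text \<open>The bound \<open>R\<close> equals \<open>\<Delta> / sqrt a\<close>, \<open>sqrt \<Delta>\<close> or \<open>sqrt b\<close> according as \<open>\<Delta>\<close> lies below, in or above \<open>[a, b]\<close>. The
integrand \<open>v^(-1/2) min 1 (\<Delta> / v)\<close> has no singularity that matters at \<open>0\<close> and decays like \<open>v^(-3/2)\<close>
beyond \<open>\<Delta>\<close>, so the integral is dominated by \<open>v\<close> near \<open>\<Delta>\<close>, or near the closest end of the interval. The factor
with \<open>a = 0\<close> is singled out because \<open>\<Delta> / 0 = 0\<close> here while the intended value is \<open>\<infinity>\<close>.\<close>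
lemma segment_estimate_sqrt:
  assumes e: "N = q - 1 / 2"
  shows "segment_estimate q r N
           (scaled_size q False (\<lambda>\<Delta> a b. sqrt b * min 1 (sqrt (\<Delta> / b)) *
              (if a = 0 then 1 else min 1 (sqrt (\<Delta> / a)))))"
proof -
  define R where "R = (\<lambda>\<Delta> a b. sqrt b * min 1 (sqrt (\<Delta> / b)) * (if a = 0 then 1 else min 1 (sqrt (\<Delta> / a))))"
  have R1: "R \<Delta> a b = \<Delta> / sqrt a" if "0 < \<Delta>" "\<Delta> \<le> a" "a \<le> b" for \<Delta> a b
    using that by (simp add: R_def real_sqrt_divide field_simps)
  have R2: "R \<Delta> a b = sqrt \<Delta>" if "0 < \<Delta>" "a < \<Delta>" "\<Delta> \<le> b" "0 \<le> a" for \<Delta> a b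
    using that by (simp add: R_def real_sqrt_divide field_simps)
  have R3: "R \<Delta> a b = sqrt b" if "b < \<Delta>" "a \<le> b" "0 \<le> a" "0 < b" for \<Delta> a b
    using that by (simp add: R_def real_sqrt_divide field_simps)
  have half: "v powr (q - N) * min 1 (\<Delta> / v) = (if v \<le> \<Delta> then sqrt v else \<Delta> / sqrt v)"
    if "0 < \<Delta>" "0 \<le> v" for \<Delta> v
  proof -
    have "q - N = 1 / 2" by (simp add: e)
    then have "v powr (q - N) = sqrt v" using that by (simp only: powr_half_sqrt)
    then show ?thesis using that by (cases "v = 0") (auto simp: field_simps)
  qed
  have head: "(\<integral>\<^sup>+v\<in>{a..s}. ennreal (v powr (1 / 2 - 1)) \<partial>lborel) \<le> ennreal (2 * sqrt s)" if "0 \<le> a" "0 \<le> s" for a s :: real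
  proof -
    have "(\<integral>\<^sup>+v\<in>{a..s}. ennreal (v powr (1 / 2 - 1)) \<partial>lborel) \<le> (\<integral>\<^sup>+v\<in>{0..s}. ennreal (v powr (1 / 2 - 1)) \<partial>lborel)"
      using that by (intro nn_integral_mono) (auto simp: indicator_def)
    also have "\<dots> = ennreal (2 * sqrt s)"
      using nn_integral_powr_from_0[of "1 / 2" s] that by (simp add: powr_half_sqrt)
    finally show ?thesis .
  qed
  have tail: "ennreal \<Delta> * (\<integral>\<^sup>+v\<in>{l..b}. ennreal (v powr (1 / 2 - 2)) \<partial>lborel) \<le> ennreal (2 * (\<Delta> / sqrt l))"
    if "0 < \<Delta>" "0 < l" "l \<le> b" for \<Delta> l b :: real
  proof -
    have "(\<integral>\<^sup>+v\<in>{l..b}. ennreal (v powr (1 / 2 - 2)) \<partial>lborel) \<le> ennreal (2 / sqrt l)"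
      using nn_integral_powr_tail_le[of l b "1 / 2"] that by (simp add: powr_minus_divide powr_half_sqrt)
    then have "ennreal \<Delta> * (\<integral>\<^sup>+v\<in>{l..b}. ennreal (v powr (1 / 2 - 2)) \<partial>lborel) \<le> ennreal \<Delta> * ennreal (2 / sqrt l)"
      by (intro mult_left_mono) auto
    also have "\<dots> = ennreal (2 * (\<Delta> / sqrt l))" using that by (simp flip: ennreal_mult' add: mult_ac)
    finally show ?thesis .
  qed
  have "segment_estimate q r N (scaled_size q False R)"
  proof (rule segment_estimate_realI)
    obtain c where c: "c > 0" and low: "\<And>\<Delta> D a b m. admissible \<Delta> D a b \<Longrightarrow> 0 < m \<Longrightarrow> a \<le> m \<Longrightarrow> m \<le> b \<Longrightarrow>
     ennreal (c * (b powr (- q) * (m powr (q - N) * min 1 (\<Delta> / m)))) \<le> segment_integral q r N D a b"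
      using segment_integral_ge_point by blast
    show "\<exists>c>0. \<forall>\<Delta> D a b. admissible \<Delta> D a b \<longrightarrow> \<not> (False \<and> a = 0) \<longrightarrow>
      ennreal (c * (b powr (- q) * R \<Delta> a b)) \<le> segment_integral q r N D a b"
    proof (rule exI[of _ c], rule conjI[OF c], intro allI impI)
      fix \<Delta> D a b assume adm: "admissible \<Delta> D a b"
      then have \<Delta>: "\<Delta> > 0" and ab: "0 \<le> a" "a \<le> b" "0 < b" by (auto simp: admissible_def)
      \<comment> \<open>The point of \<open>[a, b]\<close> closest to \<open>\<Delta>\<close>.\<close>
      define m where "m = (if \<Delta> \<le> a then a else if \<Delta> \<le> b then \<Delta> else b)"
      have m: "0 < m" "a \<le> m" "m \<le> b" using \<Delta> ab by (auto simp: m_def)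
      have "R \<Delta> a b = m powr (q - N) * min 1 (\<Delta> / m)"
        using half[of \<Delta> m] R1[of \<Delta> a b] R2[of \<Delta> a b] R3[of b \<Delta> a] \<Delta> ab m
        by (auto simp: m_def real_div_sqrt)
      then show "ennreal (c * (b powr (- q) * R \<Delta> a b)) \<le> segment_integral q r N D a b"
        using low[OF adm m] by simp
    qed
  next
    fix \<Delta> D a b assume adm: "admissible \<Delta> D a b"
    then have \<Delta>: "\<Delta> > 0" and ab: "0 \<le> a" "a \<le> b" "0 < b" by (auto simp: admissible_def)
    show "0 \<le> R \<Delta> a b" using \<Delta> ab by (simp add: R_def)
    have sq: "sqrt a \<le> sqrt b" using ab by simp
    consider "\<Delta> \<le> a" | "a < \<Delta>" "\<Delta> \<le> b" | "b < \<Delta>" by linarith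
    then show "b powr (q - N) * min 1 (\<Delta> / b) \<le> R \<Delta> a b \<and> a powr (q - N) * min 1 (\<Delta> / a) \<le> R \<Delta> a b \<and>
      (\<integral>\<^sup>+v\<in>{a..b}. ennreal (v powr (q - N - 1) * min 1 (\<Delta> / v)) \<partial>lborel) \<le> ennreal (4 * R \<Delta> a b)"
    proof cases
      case 1
      then have a: "a > 0" using \<Delta> by simp
      have "(\<integral>\<^sup>+v\<in>{a..b}. ennreal (v powr (1 / 2 - 1) * min 1 (\<Delta> / v)) \<partial>lborel)
        \<le> (\<integral>\<^sup>+v\<in>{a..a}. ennreal (v powr (1 / 2 - 1)) \<partial>lborel) + ennreal \<Delta> * (\<integral>\<^sup>+v\<in>{a..b}. ennreal (v powr (1 / 2 - 2)) \<partial>lborel)"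
        by (rule profile_integral_le) (use \<Delta> ab a in auto)
      also have "(\<integral>\<^sup>+v\<in>{a..a}. ennreal (v powr (1 / 2 - 1)) \<partial>lborel) = 0"
        using nn_integral_powr_Icc[of a a "1 / 2"] a by simp
      also have "0 + ennreal \<Delta> * (\<integral>\<^sup>+v\<in>{a..b}. ennreal (v powr (1 / 2 - 2)) \<partial>lborel) \<le> ennreal (2 * (\<Delta> / sqrt a))"
        using tail[of \<Delta> a b] a ab \<Delta> by simp
      also have "\<dots> \<le> ennreal (4 * R \<Delta> a b)"
        using R1[OF \<Delta> 1 ab(2)] a \<Delta> by (intro ennreal_leI) (simp add: divide_right_mono)
      finally have "(\<integral>\<^sup>+v\<in>{a..b}. ennreal (v powr (q - N - 1) * min 1 (\<Delta> / v)) \<partial>lborel) \<le> ennreal (4 * R \<Delta> a b)"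
        by (simp add: e)
      moreover have "\<Delta> / sqrt b \<le> \<Delta> / sqrt a" using \<Delta> a ab by (intro divide_left_mono) auto
      ultimately show ?thesis
        using half[of \<Delta> a] half[of \<Delta> b] R1[OF \<Delta> 1 ab(2)] \<Delta> ab a 1 by (auto simp: real_div_sqrt)
    next
      case 2
      have "(\<integral>\<^sup>+v\<in>{a..b}. ennreal (v powr (1 / 2 - 1) * min 1 (\<Delta> / v)) \<partial>lborel)
        \<le> (\<integral>\<^sup>+v\<in>{a..\<Delta>}. ennreal (v powr (1 / 2 - 1)) \<partial>lborel) + ennreal \<Delta> * (\<integral>\<^sup>+v\<in>{\<Delta>..b}. ennreal (v powr (1 / 2 - 2)) \<partial>lborel)"
        by (rule profile_integral_le) (use \<Delta> ab 2 in auto)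
      also have "\<dots> \<le> ennreal (2 * sqrt \<Delta>) + ennreal (2 * (\<Delta> / sqrt \<Delta>))"
        using \<Delta> ab 2 by (intro add_mono head tail) auto
      also have "\<dots> = ennreal (4 * R \<Delta> a b)"
        using R2[OF \<Delta> 2 ab(1)] \<Delta> by (simp flip: ennreal_plus add: real_div_sqrt)
      finally have "(\<integral>\<^sup>+v\<in>{a..b}. ennreal (v powr (q - N - 1) * min 1 (\<Delta> / v)) \<partial>lborel) \<le> ennreal (4 * R \<Delta> a b)"
        by (simp add: e)
      moreover have "\<Delta> / sqrt b \<le> \<Delta> / sqrt \<Delta>" using \<Delta> 2 by (intro divide_left_mono) auto
      ultimately show ?thesis
        using half[of \<Delta> a] half[of \<Delta> b] R2[OF \<Delta> 2 ab(1)] \<Delta> ab 2 by (auto simp: real_div_sqrt)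
    next
      case 3
      have "(\<integral>\<^sup>+v\<in>{a..b}. ennreal (v powr (1 / 2 - 1) * min 1 (\<Delta> / v)) \<partial>lborel)
        \<le> (\<integral>\<^sup>+v\<in>{a..b}. ennreal (v powr (1 / 2 - 1)) \<partial>lborel) + ennreal \<Delta> * (\<integral>\<^sup>+v\<in>{\<Delta>..b}. ennreal (v powr (1 / 2 - 2)) \<partial>lborel)"
        by (rule profile_integral_le) (use \<Delta> ab in auto)
      also have "(\<integral>\<^sup>+v\<in>{\<Delta>..b}. ennreal (v powr (1 / 2 - 2)) \<partial>lborel) = 0" using 3 by simp
      also have "(\<integral>\<^sup>+v\<in>{a..b}. ennreal (v powr (1 / 2 - 1)) \<partial>lborel) + ennreal \<Delta> * 0 \<le> ennreal (2 * sqrt b)"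
        using head[of a b] ab by simp
      also have "\<dots> \<le> ennreal (4 * R \<Delta> a b)"
        using R3[OF 3 ab(2,1,3)] ab by (intro ennreal_leI) simp
      finally have "(\<integral>\<^sup>+v\<in>{a..b}. ennreal (v powr (q - N - 1) * min 1 (\<Delta> / v)) \<partial>lborel) \<le> ennreal (4 * R \<Delta> a b)"
        by (simp add: e)
      then show ?thesis
        using half[of \<Delta> a] half[of \<Delta> b] R3[OF 3 ab(2,1,3)] \<Delta> ab 3 sq by auto
    qed
  qed simp_all
  then show ?thesis by (simp only: R_def)
qed

text \<open>The integrand is \<open>min 1 (\<Delta> / v)\<close>. It contributes at most \<open>\<Delta>\<close> up to \<open>v = \<Delta>\<close> and then \<open>\<Delta> ln (b / l)\<close> with
\<open>l = max \<Delta> a\<close>. The matching lower bounds are the point \<open>m = b\<close> and the range from \<open>l\<close> to \<open>(b - a) / 4\<close>.\<close>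
lemma segment_estimate_linear:
  assumes e: "N = q - 1"
  shows "segment_estimate q r N
           (scaled_size q False (\<lambda>\<Delta> a b. b * min 1 (\<Delta> / b) * max 1 (ln (((b - a) / 4) / max \<Delta> a))))"
proof (rule segment_estimate_realI)
  obtain c1 where c1: "c1 > 0" and low1: "\<And>\<Delta> D a b m. admissible \<Delta> D a b \<Longrightarrow> 0 < m \<Longrightarrow> a \<le> m \<Longrightarrow> m \<le> b \<Longrightarrow>
     ennreal (c1 * (b powr (- q) * (m powr (q - N) * min 1 (\<Delta> / m)))) \<le> segment_integral q r N D a b"
    using segment_integral_ge_point by blast
  obtain c2 where c2: "c2 > 0" and low2: "\<And>\<Delta> D a b l s \<kappa>. admissible \<Delta> D a b \<Longrightarrow> 0 < l \<Longrightarrow> a \<le> l \<Longrightarrow>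
      l \<le> s \<Longrightarrow> s \<le> b / 2 \<Longrightarrow> 0 \<le> \<kappa> \<Longrightarrow> \<forall>v\<in>{l..s}. \<kappa> / v \<le> v powr (q - N - 1) * min 1 (\<Delta> / v) \<Longrightarrow>
     ennreal (c2 * (b powr (- q) * (\<kappa> * ln (s / l)))) \<le> segment_integral q r N D a b"
    using segment_integral_ge_log by blast
  have c: "min c1 c2 > 0" using c1 c2 by simp
  show "\<exists>c>0. \<forall>\<Delta> D a b. admissible \<Delta> D a b \<longrightarrow> \<not> (False \<and> a = 0) \<longrightarrow>
      ennreal (c * (b powr (- q) * (b * min 1 (\<Delta> / b) * max 1 (ln (((b - a) / 4) / max \<Delta> a)))))
      \<le> segment_integral q r N D a b"
  proof (rule exI[of _ "min c1 c2"], rule conjI[OF c], intro allI impI)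
    fix \<Delta> D a b assume adm: "admissible \<Delta> D a b"
    then have \<Delta>: "\<Delta> > 0" and ab: "0 \<le> a" "a \<le> b" "0 < b" by (auto simp: admissible_def)
    define s where "s = (b - a) / 4"
    define l where "l = max \<Delta> a"
    have s: "s \<ge> 0" "s \<le> b / 2" "s \<le> b" using ab by (auto simp: s_def)
    have l: "l > 0" "\<Delta> \<le> l" "a \<le> l" using \<Delta> by (auto simp: l_def)
    have "ennreal (min c1 c2 * (b powr (- q) * (b * min 1 (\<Delta> / b) * max 1 (ln (s / l)))))
        \<le> segment_integral q r N D a b"
    proof (cases "ln (s / l) \<le> 1")
      case True
      then have "ennreal (min c1 c2 * (b powr (- q) * (b * min 1 (\<Delta> / b) * max 1 (ln (s / l)))))
          = ennreal (min c1 c2 * (b powr (- q) * (b * min 1 (\<Delta> / b))))" by simp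
      also have "\<dots> \<le> ennreal (c1 * (b powr (- q) * (b * min 1 (\<Delta> / b))))"
        using ab \<Delta> by (intro ennreal_leI mult_right_mono) auto
      also have "\<dots> \<le> segment_integral q r N D a b"
        using low1[OF adm, of b] ab e by simp
      finally show ?thesis .
    next
      case False
      have "s > l"
      proof (rule ccontr)
        assume "\<not> s > l"
        then have "s / l \<le> 1" using l by simp
        then have "ln (s / l) \<le> 0" using s l by (cases "s = 0") auto
        then show False using False by simp
      qed
      then have "\<Delta> \<le> b" using s l by linarith
      then have "b * min 1 (\<Delta> / b) = \<Delta>" using ab by (simp add: min_def)
      then have "ennreal (min c1 c2 * (b powr (- q) * (b * min 1 (\<Delta> / b) * max 1 (ln (s / l)))))
          = ennreal (min c1 c2 * (b powr (- q) * (\<Delta> * ln (s / l))))" using False by simp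
      also have "\<dots> \<le> ennreal (c2 * (b powr (- q) * (\<Delta> * ln (s / l))))"
        using False \<Delta> by (intro ennreal_leI mult_right_mono) auto
      also have "\<dots> \<le> segment_integral q r N D a b"
        using \<open>s > l\<close> l s \<Delta> by (intro low2[OF adm]) (auto simp: e)
      finally show ?thesis .
    qed
    then show "ennreal (min c1 c2 * (b powr (- q) * (b * min 1 (\<Delta> / b) * max 1 (ln (((b - a) / 4) / max \<Delta> a)))))
        \<le> segment_integral q r N D a b" by (simp only: s_def l_def)
  qed
next
  fix \<Delta> D a b assume adm: "admissible \<Delta> D a b"
  then have \<Delta>: "\<Delta> > 0" and ab: "0 \<le> a" "a \<le> b" "0 < b" by (auto simp: admissible_def)
  define F where "F = b * min 1 (\<Delta> / b) * max 1 (ln (((b - a) / 4) / max \<Delta> a))"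
  have mb: "b * min 1 (\<Delta> / b) = min b \<Delta>" using ab by (auto simp: min_def)
  have ma: "a * min 1 (\<Delta> / a) \<le> min b \<Delta>" using ab \<Delta> by (cases "a = 0") (auto simp: min_def field_simps)
  have "min b \<Delta> * 1 \<le> F"
    unfolding F_def mb using ab \<Delta> by (intro mult_left_mono) auto
  then have F: "min b \<Delta> \<le> F" by simp
  have "0 \<le> min b \<Delta>" using ab \<Delta> by simp
  with F show "0 \<le> b * min 1 (\<Delta> / b) * max 1 (ln (((b - a) / 4) / max \<Delta> a))"
    unfolding F_def by linarith
  have head: "(\<integral>\<^sup>+v\<in>{a..s}. ennreal (v powr (1 - 1)) \<partial>lborel) \<le> ennreal s" if "0 \<le> s" for s :: real
  proof -
    have "(\<integral>\<^sup>+v\<in>{a..s}. ennreal (v powr (1 - 1)) \<partial>lborel) \<le> (\<integral>\<^sup>+v\<in>{0..s}. ennreal (v powr (1 - 1)) \<partial>lborel)"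
      using ab by (intro nn_integral_mono) (auto simp: indicator_def)
    also have "\<dots> = ennreal s"
      using nn_integral_powr_from_0[of 1 s] that by simp
    finally show ?thesis .
  qed
  have "(\<integral>\<^sup>+v\<in>{a..b}. ennreal (v powr (1 - 1) * min 1 (\<Delta> / v)) \<partial>lborel) \<le> ennreal (5 * F)"
  proof (cases "b \<le> \<Delta>")
    case True
    \<comment> \<open>The tail range is empty here, since \<open>\<Delta> / v\<close> never falls below \<open>1\<close>.\<close>
    have "(\<integral>\<^sup>+v\<in>{a..b}. ennreal (v powr (1 - 1) * min 1 (\<Delta> / v)) \<partial>lborel)
        \<le> (\<integral>\<^sup>+v\<in>{a..b}. ennreal (v powr (1 - 1)) \<partial>lborel) + ennreal \<Delta> * (\<integral>\<^sup>+v\<in>{b + 1..b}. ennreal (v powr (1 - 2)) \<partial>lborel)"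
      by (rule profile_integral_le) (use \<Delta> ab in auto)
    also have "(\<integral>\<^sup>+v\<in>{b + 1..b}. ennreal (v powr (1 - 2)) \<partial>lborel) = 0" by simp
    also have "(\<integral>\<^sup>+v\<in>{a..b}. ennreal (v powr (1 - 1)) \<partial>lborel) + ennreal \<Delta> * 0 \<le> ennreal b"
      using head[of b] ab by simp
    also have "\<dots> \<le> ennreal (5 * F)"
      using F True ab by (intro ennreal_leI) (simp add: min_def)
    finally show ?thesis .
  next
    case False
    define l where "l = max \<Delta> a"
    have l: "0 < l" "l \<le> b" using False \<Delta> ab by (auto simp: l_def)
    have "b \<le> max (2 * l) (8 * ((b - a) / 4))"
    proof (cases "b \<le> 2 * a")
      case True
      then show ?thesis by (simp add: l_def)
    next
      case False
      then have "b \<le> 8 * ((b - a) / 4)" by simp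
      then show ?thesis by (rule max.coboundedI2)
    qed
    then have ln: "ln (b / l) \<le> 4 * max 1 (ln (((b - a) / 4) / l))"
      using ab l by (intro ln_le_of_le_max) auto
    have "(\<integral>\<^sup>+v\<in>{a..b}. ennreal (v powr (1 - 1) * min 1 (\<Delta> / v)) \<partial>lborel)
        \<le> (\<integral>\<^sup>+v\<in>{a..\<Delta>}. ennreal (v powr (1 - 1)) \<partial>lborel) + ennreal \<Delta> * (\<integral>\<^sup>+v\<in>{l..b}. ennreal (v powr (1 - 2)) \<partial>lborel)"
      by (rule profile_integral_le) (use \<Delta> l ab in \<open>auto simp: l_def\<close>)
    also have "\<dots> \<le> ennreal \<Delta> + ennreal \<Delta> * ennreal (ln (b / l))"
      using head[of \<Delta>] \<Delta> nn_integral_inverse_Icc[of l b] l by (intro add_mono mult_left_mono) auto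
    also have "\<dots> = ennreal (\<Delta> + \<Delta> * ln (b / l))"
      using \<Delta> l by (simp add: ennreal_mult)
    also have "\<dots> \<le> ennreal (5 * F)"
    proof (intro ennreal_leI)
      have "\<Delta> + \<Delta> * ln (b / l) = \<Delta> * (1 + ln (b / l))" by (simp add: distrib_left)
      also have "\<dots> \<le> \<Delta> * (5 * max 1 (ln (((b - a) / 4) / l)))"
        using ln \<Delta> by (intro mult_left_mono) linarith+
      also have "\<dots> = 5 * F" unfolding F_def mb l_def using False by (simp add: min_def)
      finally show "\<Delta> + \<Delta> * ln (b / l) \<le> 5 * F" .
    qed
    finally show ?thesis .
  qed
  moreover have "a * min 1 (\<Delta> / a) \<le> F" "b * min 1 (\<Delta> / b) \<le> F" using ma mb F by linarith+
  ultimately show "b powr (q - N) * min 1 (\<Delta> / b) \<le> b * min 1 (\<Delta> / b) * max 1 (ln (((b - a) / 4) / max \<Delta> a)) \<and>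
      a powr (q - N) * min 1 (\<Delta> / a) \<le> b * min 1 (\<Delta> / b) * max 1 (ln (((b - a) / 4) / max \<Delta> a)) \<and>
      (\<integral>\<^sup>+v\<in>{a..b}. ennreal (v powr (q - N - 1) * min 1 (\<Delta> / v)) \<partial>lborel)
      \<le> ennreal (5 * (b * min 1 (\<Delta> / b) * max 1 (ln (((b - a) / 4) / max \<Delta> a))))"
    using ab e unfolding F_def by simp
qed simp_all

end

section \<open>The normalising constants\<close>

lemma c_const_pos: "k > 0 \<Longrightarrow> c_const k > 0"
  by (simp add: c_const_def Gamma_real_pos)

text \<open>The integrand is bounded and the sphere has finite measure, so the integral is finite. It is positive because the
integrand vanishes only on the hyperplane \<open>x_i = 0\<close>, a null set.\<close>
lemma d_const_pos:
  fixes i :: "'n::finite"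
  assumes k: "k > 0"
  shows "d_const i k > 0"
proof -
  define f where "f = (\<lambda>x::real^'n. \<bar>\<alpha> i \<bullet> x\<bar> powr (2 * k))"
  have f: "f x = \<bar>sqrt 2 * x $ i\<bar> powr (2 * k)" for x
    by (simp add: f_def \<alpha>_def inner_axis' )
  have [measurable]: "f \<in> borel_measurable borel" unfolding f_def by measurable
  let ?M = "sphere_measure :: (real^'n) measure"
  have fm: "f \<in> borel_measurable ?M"
    unfolding sphere_measure_def
    by (simp add: measurable_restrict_space1 cong: measurable_cong_sets)
  have nn: "(\<integral>\<^sup>+x. ennreal (f x) \<partial>?M) = of_nat DIM(real^'n) *
      (\<integral>\<^sup>+x\<in>ball 0 1 - {0}. ennreal (f (sgn x)) \<partial>lborel)"
    unfolding sphere_measure_def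
    apply (subst nn_integral_scale_measure)
     apply (simp add: measurable_restrict_space1 cong: measurable_cong_sets)
    apply (subst nn_integral_distr[OF measurable_sgn_sphere])
     apply (simp add: measurable_restrict_space1 cong: measurable_cong_sets)
    apply (subst nn_integral_restrict_space)
    apply auto
    done
  have le: "ennreal (f (sgn x)) \<le> ennreal (sqrt 2 powr (2 * k))" for x :: "real^'n"
  proof -
    have "\<bar>sgn x $ i\<bar> \<le> norm (sgn x)" by (rule component_le_norm_cart)
    also have "\<dots> \<le> 1" by (simp add: norm_sgn)
    finally have "\<bar>sqrt 2 * sgn x $ i\<bar> \<le> sqrt 2" by (simp add: abs_mult)
    then show ?thesis unfolding f using k by (intro ennreal_leI powr_mono2) auto
  qed
  have fin: "(\<integral>\<^sup>+x\<in>ball 0 1 - {0}. ennreal (f (sgn x)) \<partial>lborel) < \<infinity>"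
  proof -
    have "(\<integral>\<^sup>+x\<in>ball 0 1 - {0}. ennreal (f (sgn x)) \<partial>lborel)
      \<le> (\<integral>\<^sup>+x. ennreal (sqrt 2 powr (2 * k)) * indicator (ball 0 1 :: (real^'n) set) x \<partial>lborel)"
      by (intro nn_integral_mono) (auto simp: indicator_def le)
    also have "\<dots> = ennreal (sqrt 2 powr (2 * k)) * emeasure lborel (ball 0 1 :: (real^'n) set)"
      by (subst nn_integral_cmult_indicator) auto
    also have "\<dots> < \<infinity>"
      using emeasure_bounded_finite[of "ball 0 1 :: (real^'n) set"] by (simp add: ennreal_mult_less_top)
    finally show ?thesis .
  qed
  have [measurable]: "(\<lambda>x::real^'n. f (sgn x)) \<in> borel_measurable borel"
    unfolding f sgn_div_norm by measurable
  have pos: "(\<integral>\<^sup>+x\<in>ball 0 1 - {0}. ennreal (f (sgn x)) \<partial>lborel) \<noteq> 0"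
  proof
    assume "(\<integral>\<^sup>+x\<in>ball 0 1 - {0}. ennreal (f (sgn x)) \<partial>lborel) = 0"
    moreover have "(\<lambda>x. ennreal (f (sgn x)) * indicator (ball 0 1 - {0}) x) \<in> borel_measurable lborel"
      by (intro borel_measurable_times_ennreal borel_measurable_indicator) auto
    ultimately have "AE x in lborel. ennreal (f (sgn x)) * indicator (ball 0 1 - {0}) x = 0"
      by (simp add: nn_integral_0_iff_AE)
    moreover have "AE x in lborel. (x::real^'n) \<notin> {x. axis i 1 \<bullet> x = 0}"
      using negligible_hyperplane[of "axis i 1 :: real^'n" 0]
      by (intro AE_not_in) (auto simp: negligible_iff_null_sets null_sets_completion_iff closed_hyperplane)
    ultimately have "AE x in lborel. x \<notin> (ball 0 1 :: (real^'n) set)"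
    proof eventually_elim
      case (elim x)
      then have xi: "x $ i \<noteq> 0" by (simp add: inner_axis')
      then have "x \<noteq> 0" by auto
      then have "sgn x $ i \<noteq> 0" using xi by (simp add: sgn_div_norm)
      then have "f (sgn x) > 0" unfolding f by simp
      then show ?case using elim(1) \<open>x \<noteq> 0\<close> by (auto simp: indicator_def split: if_splits)
    qed
    then have "emeasure lborel (ball 0 1 :: (real^'n) set) = 0"
      by (subst (asm) AE_iff_measurable[of "ball 0 1"]) auto
    then show False
      using content_ball_pos[of 1 "0 :: real^'n"] by (simp add: measure_def)
  qed
  have "d_const i k = enn2real (\<integral>\<^sup>+x. ennreal (f x) \<partial>?M)"
    unfolding d_const_def f_def[symmetric]
    by (subst integral_eq_nn_integral) (use fm in \<open>auto simp: f_def\<close>)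
  also have "\<dots> > 0"
    unfolding nn using fin pos
    by (simp add: enn2real_positive_iff of_nat_less_top ennreal_mult_less_top ennreal_zero_less_mult_iff zero_less_iff_neq_zero)
  finally show ?thesis .
qed

section \<open>The Green function as a segment integral\<close>

text \<open>Only the marked coordinate contributes to the difference, namely \<open>(x_i + y_i)^2 - (x_i - y_i)^2 = 4 x_i y_i\<close>.\<close>
lemma norm_reflection_sq:
  fixes x y :: "real ^ 'n::finite"
  shows "(norm (x - \<sigma> i y))\<^sup>2 = (norm (x - y))\<^sup>2 + 4 * (x $ i * y $ i)"
proof -
  have *: "(norm z)\<^sup>2 = (z $ i)\<^sup>2 + (\<Sum>j\<in>UNIV - {i}. (z $ j)\<^sup>2)" for z :: "real ^ 'n"
    by (simp add: norm_vec_def L2_set_def sum_nonneg sum.remove[of UNIV i])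
  have "(\<Sum>j\<in>UNIV - {i}. ((x - \<sigma> i y) $ j)\<^sup>2) = (\<Sum>j\<in>UNIV - {i}. ((x - y) $ j)\<^sup>2)"
    by (intro sum.cong) (auto simp: \<sigma>_def)
  then show ?thesis
    unfolding *[of "x - y"] *[of "x - \<sigma> i y"] by (simp add: \<sigma>_def power2_eq_square algebra_simps)
qed

lemma s_form_eq: "s_form i t x y = x \<bullet> y - (1 - t) * (x $ i * y $ i)"
  by (simp add: s_form_def inner_vec_def sum.remove[of UNIV i] algebra_simps)

lemma green_base_first:
  "(norm x)\<^sup>2 + (norm y)\<^sup>2 - 2 * s_form i t x y = (norm (x - y))\<^sup>2 + 2 * (1 - t) * (x $ i * y $ i)"
  by (simp add: s_form_eq power2_norm_eq_inner inner_diff inner_commute algebra_simps)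

lemma green_base_second:
  "1 + (norm x)\<^sup>2 * (norm y)\<^sup>2 - 2 * s_form i t x y
     = ((norm x)\<^sup>2 + (norm y)\<^sup>2 - 2 * s_form i t x y) + (1 - (norm x)\<^sup>2) * (1 - (norm y)\<^sup>2)"
  by (simp add: algebra_simps)

text \<open>The quotient of the two products is \<open>(1 + |x|) (1 + |y|)\<close>, a number between \<open>1\<close> and \<open>4\<close>.\<close>
lemma ball_defect_bounds:
  assumes "x \<in> ball 0 1" "y \<in> ball 0 1"
  shows "0 < \<delta> x * \<delta> y" "\<delta> x * \<delta> y \<le> (1 - (norm x)\<^sup>2) * (1 - (norm y)\<^sup>2)"
    "(1 - (norm x)\<^sup>2) * (1 - (norm y)\<^sup>2) \<le> 4 * (\<delta> x * \<delta> y)"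
proof -
  have n: "norm x < 1" "norm y < 1" using assms by auto
  show pos: "0 < \<delta> x * \<delta> y" using n by (simp add: \<delta>_def)
  have eq: "(1 - (norm x)\<^sup>2) * (1 - (norm y)\<^sup>2) = (1 + norm x) * (1 + norm y) * (\<delta> x * \<delta> y)"
    by (simp add: \<delta>_def power2_eq_square algebra_simps)
  have "1 * 1 \<le> (1 + norm x) * (1 + norm y)" by (intro mult_mono) auto
  then show "\<delta> x * \<delta> y \<le> (1 - (norm x)\<^sup>2) * (1 - (norm y)\<^sup>2)"
    unfolding eq using pos mult_right_mono[of 1 "(1 + norm x) * (1 + norm y)" "\<delta> x * \<delta> y"] by simp
  have "(1 + norm x) * (1 + norm y) \<le> 2 * 2" using n by (intro mult_mono) auto
  then show "(1 - (norm x)\<^sup>2) * (1 - (norm y)\<^sup>2) \<le> 4 * (\<delta> x * \<delta> y)"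
    unfolding eq using pos by (intro mult_right_mono) auto
qed

text \<open>The same integral read from either end: the substitution \<open>t = 1 - 2 u\<close> starts at \<open>|x - y|^2\<close>, and
\<open>t = 2 u - 1\<close> starts at \<open>|x - \<sigma> y|^2\<close> with the exponents of the weight exchanged. The estimates apply to the one
that starts at the smaller value.\<close>
lemma green_eq_segment_integral:
  fixes x y :: "real ^ 'n::finite" and i :: 'n and k :: real
  defines "N \<equiv> k + real CARD('n) / 2 - 1"
    and "D \<equiv> (1 - (norm x)\<^sup>2) * (1 - (norm y)\<^sup>2)"
    and "K \<equiv> c_const k * C_const i k * 2 powr (2 * k)"
  assumes K: "c_const k * C_const i k \<ge> 0"
  shows "green k i x y = ennreal K * segment_integral k (k + 1) N D ((norm (x - y))\<^sup>2) ((norm (x - \<sigma> i y))\<^sup>2)" (is ?th1)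
    and "green k i x y = ennreal K * segment_integral (k + 1) k N D ((norm (x - \<sigma> i y))\<^sup>2) ((norm (x - y))\<^sup>2)" (is ?th2)
proof -
  define a b p where "a = (norm (x - y))\<^sup>2" and "b = (norm (x - \<sigma> i y))\<^sup>2" and "p = x $ i * y $ i"
  have b: "b = a + 4 * p" by (simp add: a_def b_def p_def norm_reflection_sq)
  define f where "f = (\<lambda>t. (epowr (a + 2 * (1 - t) * p) (- N) - epowr (a + 2 * (1 - t) * p + D) (- N))
        * ennreal ((1 - t) powr (k - 1) * (1 + t) powr k) * indicator {-1<..<1} t)"
  have N: "1 - k - real CARD('n) / 2 = - N" by (simp add: N_def)
  have Kmult: "ennreal K = ennreal (c_const k * C_const i k) * ennreal (2 powr (2 * k))"
    unfolding K_def by (rule ennreal_mult[OF K]) simp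
  have green: "green k i x y = ennreal (c_const k * C_const i k) * (\<integral>\<^sup>+t. f t \<partial>lborel)"
    unfolding green_def green_base_second green_base_first f_def a_def p_def N D_def by simp
  have [measurable]: "f \<in> borel_measurable borel"
    unfolding f_def by measurable
  have scale: "(\<integral>\<^sup>+t. f t \<partial>lborel) = ennreal (2 powr (2 * k)) * S"
    if "\<And>u. 2 * f (c + d * u) = ennreal (2 powr (2 * k)) * s u" "\<bar>d\<bar> = 2" "S = (\<integral>\<^sup>+u. s u \<partial>lborel)"
      "s \<in> borel_measurable borel" for c d s S
  proof -
    have "(\<integral>\<^sup>+t. f t \<partial>lborel) = 2 * (\<integral>\<^sup>+u. f (c + d * u) \<partial>lborel)"
      using nn_integral_real_affine[of f d c] that(2) by auto
    also have "\<dots> = (\<integral>\<^sup>+u. ennreal (2 powr (2 * k)) * s u \<partial>lborel)"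
      by (simp add: nn_integral_cmult flip: that(1))
    also have "\<dots> = ennreal (2 powr (2 * k)) * S"
      using that by (simp add: nn_integral_cmult)
    finally show ?thesis .
  qed
  \<comment> \<open>The powers of \<open>2\<close> from the weight and from \<open>dt = 2 du\<close> combine to \<open>2^(2k)\<close> in both cases.\<close>
  have two: "2 * ((2 * u) powr (q - 1) * (2 * v) powr (r - 1)) = 2 powr (2 * k) * (u powr (q - 1) * v powr (r - 1))"
    if "0 < u" "0 < v" "q + r = 2 * k + 1" for u v q r :: real
  proof -
    have "2 * ((2::real) powr (q - 1) * 2 powr (r - 1)) = 2 powr (1 + ((q - 1) + (r - 1)))"
      by (simp only: powr_add powr_one_gt_zero_iff) simp
    also have "1 + ((q - 1) + (r - 1)) = 2 * k" using that by simp
    finally show ?thesis using that by (simp add: powr_mult mult_ac)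
  qed
  have e: "2 * (z * ennreal w) = ennreal (2 powr (2 * k)) * (z * ennreal w')"
    if "2 * w = 2 powr (2 * k) * w'" "0 \<le> w'" for z :: ennreal and w w' :: real
  proof -
    have "2 * (z * ennreal w) = z * ennreal (2 * w)"
      using ennreal_mult'[of 2 w] by (simp add: mult.left_commute)
    also have "\<dots> = ennreal (2 powr (2 * k)) * (z * ennreal w')"
      using that by (simp add: ennreal_mult mult_ac)
    finally show ?thesis .
  qed
  have "(\<integral>\<^sup>+t. f t \<partial>lborel) = ennreal (2 powr (2 * k)) * segment_integral k (k + 1) N D a b"
  proof (rule scale[where c = 1 and d = "-2"])
    show "2 * f (1 + - 2 * u) = ennreal (2 powr (2 * k)) *
        ((epowr ((1 - u) * a + u * b) (- N) - epowr ((1 - u) * a + u * b + D) (- N))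
          * ennreal (u powr (k - 1) * (1 - u) powr (k + 1 - 1)) * indicator {0<..<1} u)" for u
    proof (cases "u \<in> {0<..<1}")
      case True
      have "a + 2 * (1 - (1 + - 2 * u)) * p = (1 - u) * a + u * b" by (simp add: b algebra_simps)
      then have "2 * f (1 + - 2 * u) = 2 * ((epowr ((1 - u) * a + u * b) (- N) - epowr ((1 - u) * a + u * b + D) (- N))
          * ennreal ((2 * u) powr (k - 1) * (2 * (1 - u)) powr (k + 1 - 1)))"
        using True unfolding f_def by (simp add: right_diff_distrib)
      then show ?thesis using True e[OF two[of u "1 - u" k "k + 1"]] by simp
    qed (auto simp: f_def)
  qed (auto simp: segment_integral_def)
  then show ?th1
    unfolding green Kmult by (simp add: a_def b_def mult.assoc)
  have "(\<integral>\<^sup>+t. f t \<partial>lborel) = ennreal (2 powr (2 * k)) * segment_integral (k + 1) k N D b a"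
  proof (rule scale[where c = "-1" and d = 2])
    show "2 * f (-1 + 2 * u) = ennreal (2 powr (2 * k)) *
        ((epowr ((1 - u) * b + u * a) (- N) - epowr ((1 - u) * b + u * a + D) (- N))
          * ennreal (u powr (k + 1 - 1) * (1 - u) powr (k - 1)) * indicator {0<..<1} u)" for u
    proof (cases "u \<in> {0<..<1}")
      case True
      have "a + 2 * (1 - (-1 + 2 * u)) * p = (1 - u) * b + u * a" by (simp add: b algebra_simps)
      then have "2 * f (-1 + 2 * u) = 2 * ((epowr ((1 - u) * b + u * a) (- N) - epowr ((1 - u) * b + u * a + D) (- N))
          * ennreal ((2 * u) powr (k + 1 - 1) * (2 * (1 - u)) powr (k - 1)))"
        using True unfolding f_def by (simp add: right_diff_distrib mult.commute[of "(2 - 2 * u) powr (k - 1)"])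
      then show ?thesis using True e[OF two[of u "1 - u" "k + 1" k]] by simp
    qed (auto simp: f_def)
  qed (auto simp: segment_integral_def)
  then show ?th2
    unfolding green Kmult by (simp add: a_def b_def mult.assoc)
qed

lemma norm_le_reflection_iff: "norm (x - y) \<le> norm (x - \<sigma> i y) \<longleftrightarrow> x $ i * y $ i \<ge> 0"
  using norm_reflection_sq[of x i y] abs_le_square_iff[of "norm (x - y)" "norm (x - \<sigma> i y)"] by simp

lemma \<Phi>_eq: "\<Phi> i x y = (if x $ i * y $ i \<ge> 0 then norm (x - \<sigma> i y) else norm (x - y))"
  using norm_le_reflection_iff[of x y i] by (auto simp: \<Phi>_def max_def)

text \<open>Reduces an estimate of the Green function to identities between functions of the four numbers \<open>u = |x - y|\<close>,
\<open>v = |x - \<sigma> y|\<close>, \<open>|x_i y_i|\<close> and \<open>D = \<delta>(x) \<delta>(y)\<close>, one for each sign of \<open>x_i y_i\<close>. In each of them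
\<open>\<Phi>\<close> is the larger of \<open>u\<close> and \<open>v\<close>, and \<open>|x_i y_i|\<close> is a quarter of the difference of their squares.\<close>
lemma comparable_green:
  fixes F G :: "real \<Rightarrow> real \<Rightarrow> real \<Rightarrow> ennreal" and H :: "real \<Rightarrow> real \<Rightarrow> real \<Rightarrow> real \<Rightarrow> real \<Rightarrow> ereal"
  assumes k: "k > 0" and n: "CARD('n::finite) \<ge> 2"
    and N: "N = k + real CARD('n) / 2 - 1"
    and F: "segment_estimate k (k + 1) N F" and G: "segment_estimate (k + 1) k N G"
    and HF: "\<And>u v D. 0 \<le> u \<Longrightarrow> u \<le> v \<Longrightarrow> 0 < D \<Longrightarrow> H v u v ((v\<^sup>2 - u\<^sup>2) / 4) D = enn2ereal (F D (u\<^sup>2) (v\<^sup>2))"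
    and HG: "\<And>u v D. 0 \<le> v \<Longrightarrow> v < u \<Longrightarrow> 0 < D \<Longrightarrow> H u u v ((u\<^sup>2 - v\<^sup>2) / 4) D = enn2ereal (G D (v\<^sup>2) (u\<^sup>2))"
  shows "comparable (\<lambda>(i::'n) x y. enn2ereal (green k i x y))
    (\<lambda>i x y. H (\<Phi> i x y) (norm (x - y)) (norm (x - \<sigma> i y)) \<bar>x $ i * y $ i\<bar> (\<delta> x * \<delta> y))"
proof -
  define K where "K = (\<lambda>i::'n. c_const k * C_const i k * 2 powr (2 * k))"
  have cC: "c_const k * C_const i k > 0" for i :: 'n
    using c_const_pos[OF k] d_const_pos[OF k, of i] k n by (simp add: C_const_def)
  then have K: "K i > 0" for i by (simp add: K_def)
  obtain c1 C1 where 1: "c1 > 0" "C1 > 0" "\<And>\<Delta> D a b. 0 < \<Delta> \<Longrightarrow> \<Delta> \<le> D \<Longrightarrow> D \<le> 4 * \<Delta> \<Longrightarrow> 0 \<le> a \<Longrightarrow> a \<le> b \<Longrightarrow>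
        ennreal c1 * F \<Delta> a b \<le> segment_integral k (k + 1) N D a b \<and>
        segment_integral k (k + 1) N D a b \<le> ennreal C1 * F \<Delta> a b"
    using F unfolding segment_estimate_def by blast
  obtain c2 C2 where 2: "c2 > 0" "C2 > 0" "\<And>\<Delta> D a b. 0 < \<Delta> \<Longrightarrow> \<Delta> \<le> D \<Longrightarrow> D \<le> 4 * \<Delta> \<Longrightarrow> 0 \<le> a \<Longrightarrow> a \<le> b \<Longrightarrow>
        ennreal c2 * G \<Delta> a b \<le> segment_integral (k + 1) k N D a b \<and>
        segment_integral (k + 1) k N D a b \<le> ennreal C2 * G \<Delta> a b"
    using G unfolding segment_estimate_def by blast
  define M where "M = (\<lambda>i. 1 / (K i * c1) + 1 / (K i * c2) + K i * C1 + K i * C2)"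
  have M: "0 < M i" "1 / (K i * c1) \<le> M i" "1 / (K i * c2) \<le> M i" "K i * C1 \<le> M i" "K i * C2 \<le> M i" for i
    using K[of i] 1(1,2) 2(1,2) by (auto simp: M_def add_pos_pos)
  \<comment> \<open>One constant has to serve all marked coordinates; there are finitely many of them.\<close>
  define C where "C = (\<Sum>i\<in>UNIV. M i)"
  have MC: "M i \<le> C" for i
    unfolding C_def using M(1) by (intro member_le_sum) (auto intro: less_imp_le)
  have C: "C > 0" using M(1) MC by (meson less_le_trans)
  have key: "ereal (1 / C) * enn2ereal H \<le> enn2ereal (ennreal (K i) * S) \<and>
      enn2ereal (ennreal (K i) * S) \<le> ereal C * enn2ereal H"
    if "ennreal c * H \<le> S" "S \<le> ennreal c' * H" "c > 0" "c' > 0" "1 / (K i * c) \<le> M i" "K i * c' \<le> M i" for i H S c c'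
  proof -
    have e: "ereal r * enn2ereal H = enn2ereal (ennreal r * H)" if "r \<ge> 0" for r
      using that by (simp add: times_ennreal.rep_eq)
    have "1 / (K i * c) \<le> C" using that MC[of i] by linarith
    then have "1 / C \<le> K i * c" using that K[of i] C by (simp add: field_simps)
    then have "ennreal (1 / C) * H \<le> ennreal (K i * c) * H"
      by (intro mult_right_mono ennreal_leI) auto
    also have "\<dots> = ennreal (K i) * (ennreal c * H)"
      using K[of i] that by (simp add: ennreal_mult mult.assoc)
    also have "\<dots> \<le> ennreal (K i) * S" using that by (intro mult_left_mono) auto
    finally have lo: "ennreal (1 / C) * H \<le> ennreal (K i) * S" .
    have "ennreal (K i) * S \<le> ennreal (K i) * (ennreal c' * H)" using that by (intro mult_left_mono) auto
    also have "\<dots> = ennreal (K i * c') * H" using K[of i] that by (simp add: ennreal_mult mult.assoc)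
    also have "\<dots> \<le> ennreal C * H" using that MC[of i] by (intro mult_right_mono ennreal_leI) auto
    finally have hi: "ennreal (K i) * S \<le> ennreal C * H" .
    show ?thesis using lo hi C by (simp add: e less_eq_ennreal.rep_eq)
  qed
  show ?thesis
    unfolding comparable_def
  proof (rule exI[of _ C], rule conjI[OF C], intro allI ballI)
    fix i :: 'n and x y :: "real ^ 'n"
    assume xy: "x \<in> ball 0 1" "y \<in> ball 0 1"
    define g where "g = H (\<Phi> i x y) (norm (x - y)) (norm (x - \<sigma> i y)) \<bar>x $ i * y $ i\<bar> (\<delta> x * \<delta> y)"
    have "ereal (1 / C) * g \<le> enn2ereal (green k i x y) \<and> enn2ereal (green k i x y) \<le> ereal C * g"
    proof (cases "x $ i * y $ i \<ge> 0")
      case True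
      have p: "\<bar>x $ i * y $ i\<bar> = ((norm (x - \<sigma> i y))\<^sup>2 - (norm (x - y))\<^sup>2) / 4"
        unfolding norm_reflection_sq using True by simp
      have le: "norm (x - y) \<le> norm (x - \<sigma> i y)"
        using True by (simp only: norm_le_reflection_iff)
      have g: "g = enn2ereal (F (\<delta> x * \<delta> y) ((norm (x - y))\<^sup>2) ((norm (x - \<sigma> i y))\<^sup>2))"
        unfolding g_def \<Phi>_eq p if_P[OF True] by (rule HF[OF norm_ge_zero le ball_defect_bounds(1)[OF xy]])
      note est = 1(3)[OF ball_defect_bounds[OF xy] zero_le_power2 power_mono[OF le norm_ge_zero, of 2]]
      have "green k i x y = ennreal (K i) * segment_integral k (k + 1) N ((1 - (norm x)\<^sup>2) * (1 - (norm y)\<^sup>2))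
          ((norm (x - y))\<^sup>2) ((norm (x - \<sigma> i y))\<^sup>2)"
        using green_eq_segment_integral(1)[OF less_imp_le[OF cC[of i]]] by (simp add: K_def N)
      then show ?thesis
        using key[OF est[THEN conjunct1] est[THEN conjunct2] 1(1,2) M(2,4)] g
        by simp
    next
      case False
      have p: "\<bar>x $ i * y $ i\<bar> = ((norm (x - y))\<^sup>2 - (norm (x - \<sigma> i y))\<^sup>2) / 4"
        unfolding norm_reflection_sq using False by simp
      have le: "norm (x - \<sigma> i y) < norm (x - y)"
        using False by (simp only: norm_le_reflection_iff not_le[symmetric] not_False_eq_True)
      have g: "g = enn2ereal (G (\<delta> x * \<delta> y) ((norm (x - \<sigma> i y))\<^sup>2) ((norm (x - y))\<^sup>2))"
        unfolding g_def \<Phi>_eq p if_not_P[OF False] by (rule HG[OF norm_ge_zero le ball_defect_bounds(1)[OF xy]])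
      note est = 2(3)[OF ball_defect_bounds[OF xy] zero_le_power2 power_mono[OF less_imp_le[OF le] norm_ge_zero, of 2]]
      have "green k i x y = ennreal (K i) * segment_integral (k + 1) k N ((1 - (norm x)\<^sup>2) * (1 - (norm y)\<^sup>2))
          ((norm (x - \<sigma> i y))\<^sup>2) ((norm (x - y))\<^sup>2)"
        using green_eq_segment_integral(2)[OF less_imp_le[OF cC[of i]]] by (simp add: K_def N)
      then show ?thesis
        using key[OF est[THEN conjunct1] est[THEN conjunct2] 2(1,2) M(3,5)] g
        by simp
    qed
    then show "ereal (1 / C) * H (\<Phi> i x y) (norm (x - y)) (norm (x - \<sigma> i y)) \<bar>x $ i * y $ i\<bar> (\<delta> x * \<delta> y)
          \<le> enn2ereal (green k i x y) \<and>
        enn2ereal (green k i x y)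
          \<le> ereal C * H (\<Phi> i x y) (norm (x - y)) (norm (x - \<sigma> i y)) \<bar>x $ i * y $ i\<bar> (\<delta> x * \<delta> y)"
      by (simp only: g_def)
  qed
qed

section \<open>The four ranges of the dimension\<close>

lemma ereal_div_ereal: "b \<noteq> 0 \<Longrightarrow> ereal a / ereal b = ereal (a / b)"
  by simp

lemma ereal_div_zero: "a > 0 \<Longrightarrow> ereal a / 0 = \<infinity>"
  by (simp add: divide_ereal_def)

lemma min_one_ereal: "min 1 (ereal z) = ereal (min 1 z)"
  by (simp add: one_ereal_def flip: ereal_min)

text \<open>For \<open>z = 0\<close> both sides are \<open>1\<close>: the extended logarithm is \<open>-\<infinity>\<close>, and \<open>ln 0 = 0\<close> on the reals.\<close>
lemma max_one_elog: "z \<ge> 0 \<Longrightarrow> max 1 (elog (ereal z)) = ereal (max 1 (ln z))"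
  by (auto simp: elog_def one_ereal_def max_def)

lemma max_one_elog_le_one:
  assumes "z \<le> 1"
  shows "max 1 (elog (ereal z)) = 1"
proof (cases "z \<le> 0")
  case False
  then have "ln z \<le> 0" using assms by simp
  then have "max 1 (ln z) = 1" by linarith
  then show ?thesis using False max_one_elog[of z] by (simp add: one_ereal_def)
qed (auto simp: elog_def)

lemma max_one_elog_div:
  assumes "a \<ge> 0" "b > 0"
  shows "max 1 (elog (ereal a / ereal b)) = ereal (max 1 (ln (a / b)))"
  using max_one_elog[of "a / b"] assms by (simp add: ereal_div_ereal del: ereal_max)

lemma max_one_elog_div_zero: "w > 0 \<Longrightarrow> max 1 (elog (ereal w / 0)) = \<infinity>"
  by (simp add: ereal_div_zero elog_def)

lemma quarter_diff_bounds:
  fixes a b :: real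
  assumes "0 \<le> a" "a \<le> b"
  shows "0 \<le> (b - a) / 4" "(b - a) / 4 \<le> b"
  using assms by auto

lemma power2_powr: "n \<ge> 0 \<Longrightarrow> (n\<^sup>2) powr s = (n::real) powr (2 * s)"
  by (cases "n = 0") (simp_all add: powr_powr flip: powr_numeral)

lemma power2_powr_neg: "n > 0 \<Longrightarrow> (n\<^sup>2) powr (- s) = 1 / (n::real) powr (2 * s)"
  by (simp add: power2_powr powr_minus_divide)

lemma power2_powr_neg_Suc: "n > 0 \<Longrightarrow> (n\<^sup>2) powr (- (s + 1)) = 1 / ((n::real) powr (2 * s) * n\<^sup>2)"
proof -
  assume "n > 0"
  then have "(n\<^sup>2) powr (- (s + 1)) = n powr (- (2 * s + 2))" by (simp add: power2_powr)
  also have "\<dots> = 1 / (n powr (2 * s) * n\<^sup>2)"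
    using \<open>n > 0\<close> by (simp only: powr_minus_divide powr_add powr_numeral)
  finally show ?thesis .
qed

lemma min_one_square: "z \<ge> 0 \<Longrightarrow> min 1 (z\<^sup>2) = min 1 z * min 1 (z::real)"
  using power_le_one[of z 2] one_le_power[of z 2] by (auto simp: min_def power2_eq_square)

text \<open>For \<open>x_i y_i \<ge> 0\<close> the second logarithm is at most \<open>0\<close>, because \<open>|x_i y_i| \<le> |x - \<sigma> y|^2\<close>, and the first one comes from
\<open>segment_estimate_log\<close>. For \<open>x_i y_i < 0\<close> the roles are exchanged, with \<open>segment_estimate_linear\<close>.\<close>
lemma rank_one_estimate_2:
  assumes k: "k > 0" and n: "CARD('n::finite) = 2"
  shows "comparable (\<lambda>(i::'n) x y. enn2ereal (green k i x y))
          (\<lambda>i x y.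
             1 / ereal (\<Phi> i x y powr (2 * k))
             * min 1 (ereal (\<delta> x * \<delta> y) / ereal ((norm (x - y))\<^sup>2))
             * max 1 (elog (ereal (min \<bar>x $ i * y $ i\<bar> (\<delta> x * \<delta> y)) / ereal ((norm (x - y))\<^sup>2)))
             * max 1 (elog (ereal \<bar>x $ i * y $ i\<bar>
                            / ereal (max (\<delta> x * \<delta> y) ((norm (x - \<sigma> i y))\<^sup>2)))))"
proof -
  have N: "k = k + real CARD('n) / 2 - 1" by (simp add: n)
  interpret w1: weights k "k + 1" k by standard (use k in auto)
  interpret w2: weights "k + 1" k k by standard (use k in auto)
  show ?thesis
  proof (rule comparable_green[where H = "\<lambda>\<phi> u v p D. 1 / ereal (\<phi> powr (2 * k)) * min 1 (ereal D / ereal (u\<^sup>2))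
      * max 1 (elog (ereal (min p D) / ereal (u\<^sup>2))) * max 1 (elog (ereal p / ereal (max D (v\<^sup>2))))",
      OF k _ N w1.segment_estimate_log[unfolded scaled_size_def simp_thms]
        w2.segment_estimate_linear[unfolded scaled_size_def simp_thms]])
    fix u v D :: real
    assume u: "0 \<le> u" "u \<le> v" and D: "0 < D"
    define p where "p = (v\<^sup>2 - u\<^sup>2) / 4"
    have le: "u\<^sup>2 \<le> v\<^sup>2" using u by (simp add: power_mono)
    note p = quarter_diff_bounds[OF zero_le_power2 le, folded p_def]
    have mx: "max D (v\<^sup>2) > 0" using D by (simp add: less_max_iff_disj)
    have "p / max D (v\<^sup>2) \<le> 1" using p mx by (simp add: divide_le_eq_1 le_max_iff_disj)
    then have 4: "max 1 (elog (ereal p / ereal (max D (v\<^sup>2)))) = 1"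
      using mx by (subst ereal_div_ereal) (auto intro: max_one_elog_le_one)
    show "1 / ereal (v powr (2 * k)) * min 1 (ereal D / ereal (u\<^sup>2))
      * max 1 (elog (ereal (min ((v\<^sup>2 - u\<^sup>2) / 4) D) / ereal (u\<^sup>2)))
      * max 1 (elog (ereal ((v\<^sup>2 - u\<^sup>2) / 4) / ereal (max D (v\<^sup>2)))) =
      enn2ereal (if v\<^sup>2 = 0 \<or> u\<^sup>2 = 0 then \<infinity>
         else ennreal ((v\<^sup>2) powr (- k) * (min 1 (D / u\<^sup>2) * max 1 (ln (min ((v\<^sup>2 - u\<^sup>2) / 4) D / u\<^sup>2)))))"
      unfolding p_def[symmetric] 4
    proof (cases "u = 0")
      case True
      show "1 / ereal (v powr (2 * k)) * min 1 (ereal D / ereal (u\<^sup>2)) * max 1 (elog (ereal (min p D) / ereal (u\<^sup>2))) * 1 =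
        enn2ereal (if v\<^sup>2 = 0 \<or> u\<^sup>2 = 0 then \<infinity>
         else ennreal ((v\<^sup>2) powr (- k) * (min 1 (D / u\<^sup>2) * max 1 (ln (min p D / u\<^sup>2)))))"
      proof (cases "v = 0")
        case v: True
        then show ?thesis using True D by (simp add: p_def ereal_div_zero elog_def)
      next
        case False
        then have "min p D > 0" "v powr (2 * k) > 0" using True u D by (auto simp: p_def)
        moreover have "ereal (u\<^sup>2) = 0" using True by simp
        moreover from calculation have "max 1 (elog (ereal (min p D) / ereal (u\<^sup>2))) = \<infinity>"
          by (simp only: max_one_elog_div_zero)
        moreover have "1 / ereal (v powr (2 * k)) > 0" using False by (simp add: one_ereal_def)
        ultimately show ?thesis using True False D
          by (simp add: ereal_div_zero)
      qed
    next
      case False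
      then have v: "v > 0" "v powr (2 * k) \<noteq> 0" using u by auto
      have 3: "max 1 (elog (ereal (min p D) / ereal (u\<^sup>2))) = ereal (max 1 (ln (min p D / u\<^sup>2)))"
        using D p False by (intro max_one_elog_div) auto
      show "1 / ereal (v powr (2 * k)) * min 1 (ereal D / ereal (u\<^sup>2)) * max 1 (elog (ereal (min p D) / ereal (u\<^sup>2))) * 1 =
        enn2ereal (if v\<^sup>2 = 0 \<or> u\<^sup>2 = 0 then \<infinity>
         else ennreal ((v\<^sup>2) powr (- k) * (min 1 (D / u\<^sup>2) * max 1 (ln (min p D / u\<^sup>2)))))"
        unfolding 3
        using v False p D
        by (simp add: ereal_div_ereal min_one_ereal max_one_elog power2_powr_neg one_ereal_def mult_ac flip: ereal_min ereal_max)
    qed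
  next
    fix u v D :: real
    assume u: "0 \<le> v" "v < u" and D: "0 < D"
    define p where "p = (u\<^sup>2 - v\<^sup>2) / 4"
    have le: "v\<^sup>2 \<le> u\<^sup>2" using u by (simp add: power_mono)
    note p = quarter_diff_bounds[OF zero_le_power2 le, folded p_def]
    have mx: "max D (v\<^sup>2) > 0" using D by (simp add: less_max_iff_disj)
    have u0: "u > 0" "u powr (2 * k) \<noteq> 0" using u by auto
    have "min p D / u\<^sup>2 \<le> 1" using p u0 by (simp add: divide_le_eq_1 min_le_iff_disj)
    then have 3: "max 1 (elog (ereal (min p D) / ereal (u\<^sup>2))) = 1"
      using u0 by (subst ereal_div_ereal) (auto intro: max_one_elog_le_one)
    show "1 / ereal (u powr (2 * k)) * min 1 (ereal D / ereal (u\<^sup>2))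
      * max 1 (elog (ereal (min ((u\<^sup>2 - v\<^sup>2) / 4) D) / ereal (u\<^sup>2)))
      * max 1 (elog (ereal ((u\<^sup>2 - v\<^sup>2) / 4) / ereal (max D (v\<^sup>2)))) =
      enn2ereal (if u\<^sup>2 = 0 then \<infinity>
         else ennreal ((u\<^sup>2) powr (- (k + 1)) * (u\<^sup>2 * min 1 (D / u\<^sup>2) * max 1 (ln (((u\<^sup>2 - v\<^sup>2) / 4) / max D (v\<^sup>2))))))"
      unfolding p_def[symmetric] 3 max_one_elog_div[OF p(1) mx] power2_powr_neg_Suc[OF u0(1)]
      using u0 p mx D
      by (simp add: ereal_div_ereal min_one_ereal max_one_elog one_ereal_def mult_ac flip: ereal_min ereal_max)
  qed (use n in simp_all)
qed

text \<open>For \<open>x_i y_i \<ge> 0\<close> the minimum of the two distances is \<open>|x - y|\<close>, so that the two brackets coincide and their product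
is \<open>min 1 (D / |x - y|^2)\<close>.\<close>
lemma rank_one_estimate_3:
  assumes k: "k > 0" and n: "CARD('n::finite) = 3"
  shows "comparable (\<lambda>(i::'n) x y. enn2ereal (green k i x y))
          (\<lambda>i x y.
             1 / ereal (\<Phi> i x y powr (2 * k) * norm (x - y))
             * min 1 (ereal (sqrt (\<delta> x * \<delta> y)) / ereal (norm (x - y)))
             * min 1 (ereal (sqrt (\<delta> x * \<delta> y))
                      / ereal (min (norm (x - y)) (norm (x - \<sigma> i y)))))"
proof -
  have N: "k + 1 / 2 = k + real CARD('n) / 2 - 1" by (simp add: n)
  interpret w1: weights k "k + 1" "k + 1 / 2" by standard (use k in auto)
  interpret w2: weights "k + 1" k "k + 1 / 2" by standard (use k in auto)
  show ?thesis
  proof (rule comparable_green[where H = "\<lambda>\<phi> u v p D. 1 / ereal (\<phi> powr (2 * k) * u) * min 1 (ereal (sqrt D) / ereal u)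
      * min 1 (ereal (sqrt D) / ereal (min u v))",
      OF k _ N w1.segment_estimate_power[unfolded scaled_size_def simp_thms]
        w2.segment_estimate_sqrt[unfolded scaled_size_def simp_thms]])
    fix u v D :: real
    assume u: "0 \<le> u" "u \<le> v" and D: "0 < D"
    have mn: "min u v = u" using u by simp
    show "1 / ereal (v powr (2 * k) * u) * min 1 (ereal (sqrt D) / ereal u) * min 1 (ereal (sqrt D) / ereal (min u v)) =
      enn2ereal (if v\<^sup>2 = 0 \<or> u\<^sup>2 = 0 then \<infinity>
         else ennreal ((v\<^sup>2) powr (- k) * ((u\<^sup>2) powr (k - (k + 1 / 2)) * min 1 (D / u\<^sup>2))))"
      unfolding mn
    proof (cases "u = 0")
      case True
      then show "1 / ereal (v powr (2 * k) * u) * min 1 (ereal (sqrt D) / ereal u) * min 1 (ereal (sqrt D) / ereal u) =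
        enn2ereal (if v\<^sup>2 = 0 \<or> u\<^sup>2 = 0 then \<infinity>
         else ennreal ((v\<^sup>2) powr (- k) * ((u\<^sup>2) powr (k - (k + 1 / 2)) * min 1 (D / u\<^sup>2))))"
        using D by (simp add: ereal_div_zero one_ereal_def flip: zero_ereal_def)
    next
      case False
      then have u0: "u > 0" "v > 0" "v powr (2 * k) \<noteq> 0" using u by auto
      have sq: "min 1 (D / u\<^sup>2) = min 1 (sqrt D / u) * min 1 (sqrt D / u)"
        using u0 D min_one_square[of "sqrt D / u"] by (simp add: power_divide)
      have pw: "(u\<^sup>2) powr (k - (k + 1 / 2)) = 1 / u" using power2_powr_neg[of u "1 / 2"] u0 by simp
      show "1 / ereal (v powr (2 * k) * u) * min 1 (ereal (sqrt D) / ereal u) * min 1 (ereal (sqrt D) / ereal u) =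
        enn2ereal (if v\<^sup>2 = 0 \<or> u\<^sup>2 = 0 then \<infinity>
         else ennreal ((v\<^sup>2) powr (- k) * ((u\<^sup>2) powr (k - (k + 1 / 2)) * min 1 (D / u\<^sup>2))))"
        unfolding sq pw
        using u0 D
        by (simp add: ereal_div_ereal min_one_ereal power2_powr_neg one_ereal_def mult_ac flip: ereal_min)
    qed
  next
    fix u v D :: real
    assume u: "0 \<le> v" "v < u" and D: "0 < D"
    have mn: "min u v = v" using u by simp
    have u0: "u > 0" "u powr (2 * k) \<noteq> 0" using u by auto
    show "1 / ereal (u powr (2 * k) * u) * min 1 (ereal (sqrt D) / ereal u) * min 1 (ereal (sqrt D) / ereal (min u v)) =
      enn2ereal (if u\<^sup>2 = 0 then \<infinity>
         else ennreal ((u\<^sup>2) powr (- (k + 1)) * (sqrt (u\<^sup>2) * min 1 (sqrt (D / u\<^sup>2)) *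
            (if v\<^sup>2 = 0 then 1 else min 1 (sqrt (D / v\<^sup>2))))))"
      unfolding mn power2_powr_neg_Suc[OF u0(1)]
      using u0 u D
      by (cases "v = 0") (simp_all add: ereal_div_ereal ereal_div_zero min_one_ereal real_sqrt_divide one_ereal_def power2_eq_square mult_ac
          flip: ereal_min ereal_max flip: zero_ereal_def)
  qed (use n in simp_all)
qed

text \<open>The logarithm is at most \<open>0\<close> for \<open>x_i y_i \<ge> 0\<close>, because \<open>|x_i y_i| \<le> |x - \<sigma> y|^2\<close>. If in addition \<open>x - \<sigma> y = 0\<close>, then
\<open>x = y\<close> has \<open>x_i = 0\<close>, and the argument of the logarithm is \<open>0 / 0\<close>, whose bracket is \<open>1\<close>.\<close>
lemma rank_one_estimate_4:
  assumes k: "k > 0" and n: "CARD('n::finite) = 4"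
  shows "comparable (\<lambda>(i::'n) x y. enn2ereal (green k i x y))
          (\<lambda>i x y.
             1 / ereal (\<Phi> i x y powr (2 * k) * (norm (x - y))\<^sup>2)
             * min 1 (ereal (\<delta> x * \<delta> y)
                      / ereal (min ((norm (x - y))\<^sup>2) ((norm (x - \<sigma> i y))\<^sup>2)))
             * max 1 (elog (ereal (min \<bar>x $ i * y $ i\<bar> (\<delta> x * \<delta> y))
                            / ereal ((norm (x - \<sigma> i y))\<^sup>2))))"
proof -
  have N: "k + 1 = k + real CARD('n) / 2 - 1" by (simp add: n)
  interpret w1: weights k "k + 1" "k + 1" by standard (use k in auto)
  interpret w2: weights "k + 1" k "k + 1" by standard (use k in auto)
  show ?thesis
  proof (rule comparable_green[where H = "\<lambda>\<phi> u v p D. 1 / ereal (\<phi> powr (2 * k) * u\<^sup>2)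
      * min 1 (ereal D / ereal (min (u\<^sup>2) (v\<^sup>2))) * max 1 (elog (ereal (min p D) / ereal (v\<^sup>2)))",
      OF k _ N w1.segment_estimate_power[unfolded scaled_size_def simp_thms]
        w2.segment_estimate_log[unfolded scaled_size_def simp_thms]])
    fix u v D :: real
    assume u: "0 \<le> u" "u \<le> v" and D: "0 < D"
    define p where "p = (v\<^sup>2 - u\<^sup>2) / 4"
    have le: "u\<^sup>2 \<le> v\<^sup>2" using u by (simp add: power_mono)
    note p = quarter_diff_bounds[OF zero_le_power2 le, folded p_def]
    have mn: "min (u\<^sup>2) (v\<^sup>2) = u\<^sup>2" using le by simp
    have 3: "max 1 (elog (ereal (min p D) / ereal (v\<^sup>2))) = 1"
    proof (cases "v = 0")
      case True
      then have "p = 0" using p by simp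
      then show ?thesis using True D by (simp add: elog_def)
    next
      case False
      have "min p D / v\<^sup>2 \<le> 1" using p False by (simp add: divide_le_eq_1 min_le_iff_disj)
      then show ?thesis using False by (subst ereal_div_ereal) (auto intro: max_one_elog_le_one)
    qed
    show "1 / ereal (v powr (2 * k) * u\<^sup>2) * min 1 (ereal D / ereal (min (u\<^sup>2) (v\<^sup>2)))
        * max 1 (elog (ereal (min ((v\<^sup>2 - u\<^sup>2) / 4) D) / ereal (v\<^sup>2))) =
      enn2ereal (if v\<^sup>2 = 0 \<or> u\<^sup>2 = 0 then \<infinity>
         else ennreal ((v\<^sup>2) powr (- k) * ((u\<^sup>2) powr (k - (k + 1)) * min 1 (D / u\<^sup>2))))"
      unfolding p_def[symmetric] 3 mn
    proof (cases "u = 0")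
      case True
      then show "1 / ereal (v powr (2 * k) * u\<^sup>2) * min 1 (ereal D / ereal (u\<^sup>2)) * 1 =
        enn2ereal (if v\<^sup>2 = 0 \<or> u\<^sup>2 = 0 then \<infinity>
         else ennreal ((v\<^sup>2) powr (- k) * ((u\<^sup>2) powr (k - (k + 1)) * min 1 (D / u\<^sup>2))))"
        using D by (simp add: ereal_div_zero one_ereal_def flip: zero_ereal_def)
    next
      case False
      then have u0: "u > 0" "v > 0" "v powr (2 * k) \<noteq> 0" using u by auto
      have "(u\<^sup>2) powr (k - (k + 1)) = 1 / u\<^sup>2" using u0 by (simp add: powr_minus_divide)
      then show "1 / ereal (v powr (2 * k) * u\<^sup>2) * min 1 (ereal D / ereal (u\<^sup>2)) * 1 =
        enn2ereal (if v\<^sup>2 = 0 \<or> u\<^sup>2 = 0 then \<infinity>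
         else ennreal ((v\<^sup>2) powr (- k) * ((u\<^sup>2) powr (k - (k + 1)) * min 1 (D / u\<^sup>2))))"
        using u0 D
        by (simp add: ereal_div_ereal min_one_ereal power2_powr_neg one_ereal_def mult_ac flip: ereal_min ereal_max)
    qed
  next
    fix u v D :: real
    assume u: "0 \<le> v" "v < u" and D: "0 < D"
    define p where "p = (u\<^sup>2 - v\<^sup>2) / 4"
    have lt: "v\<^sup>2 < u\<^sup>2" using u by (simp add: power_strict_mono)
    then have p: "0 < p" by (auto simp: p_def)
    have mn: "min (u\<^sup>2) (v\<^sup>2) = v\<^sup>2" using lt by simp
    have u0: "u > 0" "u powr (2 * k) \<noteq> 0" using u by auto
    show "1 / ereal (u powr (2 * k) * u\<^sup>2) * min 1 (ereal D / ereal (min (u\<^sup>2) (v\<^sup>2)))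
        * max 1 (elog (ereal (min ((u\<^sup>2 - v\<^sup>2) / 4) D) / ereal (v\<^sup>2))) =
      enn2ereal (if u\<^sup>2 = 0 \<or> v\<^sup>2 = 0 then \<infinity>
         else ennreal ((u\<^sup>2) powr (- (k + 1)) * (min 1 (D / v\<^sup>2) * max 1 (ln (min ((u\<^sup>2 - v\<^sup>2) / 4) D / v\<^sup>2)))))"
      unfolding mn p_def[symmetric] power2_powr_neg_Suc[OF u0(1)]
    proof (cases "v = 0")
      case True
      then have "ereal (v\<^sup>2) = 0" by simp
      moreover have "min p D > 0" using D p by simp
      ultimately have "max 1 (elog (ereal (min p D) / ereal (v\<^sup>2))) = \<infinity>"
        by (simp only: max_one_elog_div_zero)
      with True show "1 / ereal (u powr (2 * k) * u\<^sup>2) * min 1 (ereal D / ereal (v\<^sup>2)) * max 1 (elog (ereal (min p D) / ereal (v\<^sup>2))) =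
        enn2ereal (if u\<^sup>2 = 0 \<or> v\<^sup>2 = 0 then \<infinity>
          else ennreal (1 / (u powr (2 * k) * u\<^sup>2) * (min 1 (D / v\<^sup>2) * max 1 (ln (min p D / v\<^sup>2)))))"
        using D p u0 by (simp add: ereal_div_zero one_ereal_def flip: zero_ereal_def)
    next
      case False
      then have "max 1 (elog (ereal (min p D) / ereal (v\<^sup>2))) = ereal (max 1 (ln (min p D / v\<^sup>2)))"
        using D p by (intro max_one_elog_div) auto
      with False show "1 / ereal (u powr (2 * k) * u\<^sup>2) * min 1 (ereal D / ereal (v\<^sup>2)) * max 1 (elog (ereal (min p D) / ereal (v\<^sup>2))) =
        enn2ereal (if u\<^sup>2 = 0 \<or> v\<^sup>2 = 0 then \<infinity>
          else ennreal (1 / (u powr (2 * k) * u\<^sup>2) * (min 1 (D / v\<^sup>2) * max 1 (ln (min p D / v\<^sup>2)))))"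
        using D p u0
        by (simp add: ereal_div_ereal min_one_ereal max_one_elog one_ereal_def mult_ac flip: ereal_min ereal_max)
    qed
  qed (use n in simp_all)
qed

text \<open>Both signs of \<open>x_i y_i\<close> fall under \<open>segment_estimate_power\<close>; the different exponents \<open>1 - d/2\<close> and \<open>2 - d/2\<close> of the
smaller squared distance account for the mixed denominator.\<close>
lemma rank_one_estimate_ge_5:
  assumes k: "k > 0" and n: "CARD('n::finite) \<ge> 5"
  shows "comparable (\<lambda>(i::'n) x y. enn2ereal (green k i x y))
          (\<lambda>i x y.
             1 / ereal (\<Phi> i x y powr (2 * k)
                        * min (norm (x - y)) (norm (x - \<sigma> i y)) ^ (CARD('n) - 4)
                        * (norm (x - y))\<^sup>2)
             * min 1 (ereal (\<delta> x * \<delta> y)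
                      / ereal (min ((norm (x - y))\<^sup>2) ((norm (x - \<sigma> i y))\<^sup>2))))"
proof -
  define d where "d = CARD('n)"
  define N where "N = k + real CARD('n) / 2 - 1"
  have d: "d \<ge> 5" using n by (simp add: d_def)
  have Nd: "N = k + real d / 2 - 1" by (simp add: N_def d_def)
  interpret w1: weights k "k + 1" N by standard (use k d in \<open>auto simp: Nd\<close>)
  interpret w2: weights "k + 1" k N by standard (use k d in \<open>auto simp: Nd\<close>)
  have pw: "(s\<^sup>2) powr (k + 1 - N) = 1 / s ^ (d - 4)" if "s > 0" for s :: real
  proof -
    have "2 * (k + 1 - N) = - real (d - 4)" using d by (simp add: Nd of_nat_diff)
    then have "(s\<^sup>2) powr (k + 1 - N) = s powr (- real (d - 4))" using that by (simp only: power2_powr less_imp_le)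
    then show ?thesis using that by (simp only: powr_minus_divide powr_realpow)
  qed
  show ?thesis
    unfolding d_def[symmetric]
  proof (rule comparable_green[where H = "\<lambda>\<phi> u v p D. 1 / ereal (\<phi> powr (2 * k) * min u v ^ (d - 4) * u\<^sup>2)
      * min 1 (ereal D / ereal (min (u\<^sup>2) (v\<^sup>2)))",
      OF k _ N_def w1.segment_estimate_power[unfolded scaled_size_def simp_thms]
        w2.segment_estimate_power[unfolded scaled_size_def simp_thms]])
    fix u v D :: real
    assume u: "0 \<le> u" "u \<le> v" and D: "0 < D"
    have mn: "min (u\<^sup>2) (v\<^sup>2) = u\<^sup>2" "min u v = u" using u by (auto simp: power_mono)
    show "1 / ereal (v powr (2 * k) * min u v ^ (d - 4) * u\<^sup>2) * min 1 (ereal D / ereal (min (u\<^sup>2) (v\<^sup>2))) =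
      enn2ereal (if v\<^sup>2 = 0 \<or> u\<^sup>2 = 0 then \<infinity>
         else ennreal ((v\<^sup>2) powr (- k) * ((u\<^sup>2) powr (k - N) * min 1 (D / u\<^sup>2))))"
      unfolding mn
    proof (cases "u = 0")
      case True
      then show "1 / ereal (v powr (2 * k) * u ^ (d - 4) * u\<^sup>2) * min 1 (ereal D / ereal (u\<^sup>2)) =
        enn2ereal (if v\<^sup>2 = 0 \<or> u\<^sup>2 = 0 then \<infinity>
         else ennreal ((v\<^sup>2) powr (- k) * ((u\<^sup>2) powr (k - N) * min 1 (D / u\<^sup>2))))"
        using D by (simp add: ereal_div_zero one_ereal_def flip: zero_ereal_def)
    next
      case False
      then have u0: "u > 0" "v > 0" "v powr (2 * k) \<noteq> 0" using u by auto
      have "k - N = (k + 1 - N) + - 1" by simp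
      then have "(u\<^sup>2) powr (k - N) = (u\<^sup>2) powr (k + 1 - N) * (u\<^sup>2) powr (- 1)" by (simp only: powr_add)
      also have "\<dots> = 1 / (u ^ (d - 4) * u\<^sup>2)" using u0 by (simp add: pw powr_minus_divide)
      finally have "(u\<^sup>2) powr (k - N) = 1 / (u ^ (d - 4) * u\<^sup>2)" .
      then show "1 / ereal (v powr (2 * k) * u ^ (d - 4) * u\<^sup>2) * min 1 (ereal D / ereal (u\<^sup>2)) =
        enn2ereal (if v\<^sup>2 = 0 \<or> u\<^sup>2 = 0 then \<infinity>
         else ennreal ((v\<^sup>2) powr (- k) * ((u\<^sup>2) powr (k - N) * min 1 (D / u\<^sup>2))))"
        using u0 D
        by (simp add: ereal_div_ereal min_one_ereal power2_powr_neg one_ereal_def mult_ac flip: ereal_min ereal_max)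
    qed
  next
    fix u v D :: real
    assume u: "0 \<le> v" "v < u" and D: "0 < D"
    have mn: "min (u\<^sup>2) (v\<^sup>2) = v\<^sup>2" "min u v = v" using u by (auto simp: power_mono)
    have u0: "u > 0" "u powr (2 * k) \<noteq> 0" using u by auto
    show "1 / ereal (u powr (2 * k) * min u v ^ (d - 4) * u\<^sup>2) * min 1 (ereal D / ereal (min (u\<^sup>2) (v\<^sup>2))) =
      enn2ereal (if u\<^sup>2 = 0 \<or> v\<^sup>2 = 0 then \<infinity>
         else ennreal ((u\<^sup>2) powr (- (k + 1)) * ((v\<^sup>2) powr (k + 1 - N) * min 1 (D / v\<^sup>2))))"
      unfolding mn power2_powr_neg_Suc[OF u0(1)]
      using u0 u D d
      by (cases "v = 0") (simp_all add: ereal_div_ereal ereal_div_zero min_one_ereal pw one_ereal_def mult_ac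
          flip: ereal_min ereal_max flip: zero_ereal_def)
  qed (use d in \<open>auto simp: d_def Nd\<close>)
qed

theorem theorem5p4:
  fixes k :: real
  assumes "CARD('n::finite) \<ge> 2" and "k > 0"
  shows
    "(CARD('n) = 2 \<longrightarrow>
        comparable (\<lambda>(i::'n) x y. enn2ereal (green k i x y))
          (\<lambda>i x y.
             1 / ereal (\<Phi> i x y powr (2 * k))
             * min 1 (ereal (\<delta> x * \<delta> y) / ereal ((norm (x - y))\<^sup>2))
             * max 1 (elog (ereal (min \<bar>x $ i * y $ i\<bar> (\<delta> x * \<delta> y)) / ereal ((norm (x - y))\<^sup>2)))
             * max 1 (elog (ereal \<bar>x $ i * y $ i\<bar>
                            / ereal (max (\<delta> x * \<delta> y) ((norm (x - \<sigma> i y))\<^sup>2))))))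
   \<and> (CARD('n) = 3 \<longrightarrow>
        comparable (\<lambda>(i::'n) x y. enn2ereal (green k i x y))
          (\<lambda>i x y.
             1 / ereal (\<Phi> i x y powr (2 * k) * norm (x - y))
             * min 1 (ereal (sqrt (\<delta> x * \<delta> y)) / ereal (norm (x - y)))
             * min 1 (ereal (sqrt (\<delta> x * \<delta> y))
                      / ereal (min (norm (x - y)) (norm (x - \<sigma> i y))))))
   \<and> (CARD('n) = 4 \<longrightarrow>
        comparable (\<lambda>(i::'n) x y. enn2ereal (green k i x y))
          (\<lambda>i x y.
             1 / ereal (\<Phi> i x y powr (2 * k) * (norm (x - y))\<^sup>2)
             * min 1 (ereal (\<delta> x * \<delta> y)
                      / ereal (min ((norm (x - y))\<^sup>2) ((norm (x - \<sigma> i y))\<^sup>2)))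
             * max 1 (elog (ereal (min \<bar>x $ i * y $ i\<bar> (\<delta> x * \<delta> y))
                            / ereal ((norm (x - \<sigma> i y))\<^sup>2)))))
   \<and> (CARD('n) \<ge> 5 \<longrightarrow>
        comparable (\<lambda>(i::'n) x y. enn2ereal (green k i x y))
          (\<lambda>i x y.
             1 / ereal (\<Phi> i x y powr (2 * k)
                        * min (norm (x - y)) (norm (x - \<sigma> i y)) ^ (CARD('n) - 4)
                        * (norm (x - y))\<^sup>2)
             * min 1 (ereal (\<delta> x * \<delta> y)
                      / ereal (min ((norm (x - y))\<^sup>2) ((norm (x - \<sigma> i y))\<^sup>2)))))"
  by (intro conjI impI rank_one_estimate_2 rank_one_estimate_3 rank_one_estimate_4 rank_one_estimate_ge_5
      assms(2))

end
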